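(* The complex hyperbolic plane $\mathbb{H}_{\mathbb{C}}^2$ admits no (non-empty) complete totally geodesic submanifold of real dimension three.
   Context: Let $\mathbb{C}^3$ be endowed with the Hermitian form $\langle x,y\rangle=-x_0\overline{y_0}+x_1\overline{y_1}+x_2\overline{y_2}$. The complex hyperbolic plane is $\mathbb{H}_{\mathbb{C}}^2=\{[p]\in\mathbb{P}_{\mathbb{C}}(\mathbb{C}^3):\langle p,p\rangle<0\}$. Its tangent space at $[p]$ is identified with the space of $\mathbb{C}$-linear maps $\mathbb{C}p\to p^\perp$, where $p^\perp$ is the orthogonal complement of $p$ with respect to the Hermitian form, and it carries the positive-definite Hermitian metric $\langle t_1,t_2\rangle=-\langle t_1(p),t_2(p)\rangle/\langle p,p\rangle$; the Riemannian metric on $\mathbb{H}_{\mathbb{C}}^2$ is $g=\operatorname{Re}\langle\cdot,\cdot\rangle$. A submanifold $S$ of $\mathbb{H}_{\mathbb{C}}^2$ is totally geodesic if the (Riemannian) geodesics of $S$ with its induced metric are geodesics of $\mathbb{H}_{\mathbb{C}}^2$; it is complete if it is complete for the induced Riemannian metric. *)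

theory Defs
  imports "HOL-Analysis.Analysis"
begin

subsection \<open>Smooth maps between open subsets of Euclidean spaces\<close>

text \<open>All iterated directional derivatives are required, which in finite dimension and on an
  open set is the usual notion of a \<open>C\<^sup>k\<close> map.\<close>

primrec times_differentiable_on ::
  "nat \<Rightarrow> 'a::euclidean_space set \<Rightarrow> ('a \<Rightarrow> 'b::euclidean_space) \<Rightarrow> bool" where
  "times_differentiable_on 0 U f \<longleftrightarrow> continuous_on U f"
| "times_differentiable_on (Suc k) U f \<longleftrightarrow>
     (\<forall>x\<in>U. f differentiable (at x)) \<and>
     (\<forall>v. times_differentiable_on k U (\<lambda>x. frechet_derivative f (at x) v))"

definition smooth_on :: "'a::euclidean_space set \<Rightarrow> ('a \<Rightarrow> 'b::euclidean_space) \<Rightarrow> bool" where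
  "smooth_on U f \<longleftrightarrow> (\<forall>k. times_differentiable_on k U f)"


subsection \<open>The complex hyperbolic plane\<close>

text \<open>The index type \<open>3\<close> consists of \<open>0\<close>, \<open>1\<close>, \<open>2\<close> (with \<open>3 = 0\<close>).\<close>

definition herm :: "complex ^ 3 \<Rightarrow> complex ^ 3 \<Rightarrow> complex" where
  "herm x y = - x $ 0 * cnj (y $ 0) + x $ 1 * cnj (y $ 1) + x $ 2 * cnj (y $ 2)"

text \<open>The point \<open>[p]\<close> of the projective plane is the complex line spanned by \<open>p\<close>.\<close>

definition cline :: "complex ^ 3 \<Rightarrow> (complex ^ 3) set" where
  "cline p = range (\<lambda>c. c *s p)"

text \<open>The number \<open>herm p p\<close> is real for every \<open>p\<close>.\<close>

definition CH2 :: "(complex ^ 3) set set" where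
  "CH2 = {cline p | p. p \<noteq> 0 \<and> Re (herm p p) < 0}"

definition perp_proj :: "complex ^ 3 \<Rightarrow> complex ^ 3 \<Rightarrow> complex ^ 3" where
  "perp_proj p x = x - (herm x p / herm p p) *s p"

text \<open>A linear map \<open>\<complex>p \<rightarrow> p\<^sup>\<bottom>\<close> is represented by the function extending it by zero outside of
  the line \<open>L = \<complex>p\<close>.\<close>

definition tangent_CH2 :: "(complex ^ 3) set \<Rightarrow> (complex ^ 3 \<Rightarrow> complex ^ 3) set" where
  "tangent_CH2 L = {t. (\<forall>p\<in>L. \<forall>q\<in>L. t (p + q) = t p + t q) \<and>
                       (\<forall>p\<in>L. \<forall>c. t (c *s p) = c *s t p) \<and>
                       (\<forall>p\<in>L. \<forall>q\<in>L. herm (t p) q = 0) \<and>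
                       (\<forall>p. p \<notin> L \<longrightarrow> t p = 0)}"

text \<open>The value does not depend on the chosen \<open>p\<close>; see \<open>tangent_herm_eq\<close> below.\<close>

definition tangent_herm ::
  "(complex ^ 3) set \<Rightarrow> (complex ^ 3 \<Rightarrow> complex ^ 3) \<Rightarrow> (complex ^ 3 \<Rightarrow> complex ^ 3) \<Rightarrow> complex"
  where "tangent_herm L t\<^sub>1 t\<^sub>2 =
    (let p = (SOME p. p \<in> L \<and> p \<noteq> 0) in - herm (t\<^sub>1 p) (t\<^sub>2 p) / herm p p)"

definition riem_CH2 ::
  "(complex ^ 3) set \<Rightarrow> (complex ^ 3 \<Rightarrow> complex ^ 3) \<Rightarrow> (complex ^ 3 \<Rightarrow> complex ^ 3) \<Rightarrow> real"
  where "riem_CH2 L t\<^sub>1 t\<^sub>2 = Re (tangent_herm L t\<^sub>1 t\<^sub>2)"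

text \<open>A negative line is not contained in the plane where the coordinate of index 0 vanishes, so
  \<open>CH2\<close> lies in the domain of a single affine chart \<open>[p] \<mapsto> (p\<^sub>1/p\<^sub>0, p\<^sub>2/p\<^sub>0)\<close> of the projective
  plane, which defines its smooth structure.\<close>

definition affine_lift :: "complex ^ 2 \<Rightarrow> complex ^ 3" where
  "affine_lift z = (\<chi> i. if i = 0 then 1 else if i = 1 then z $ 1 else z $ 2)"

definition affine_coord :: "(complex ^ 3) set \<Rightarrow> complex ^ 2" where
  "affine_coord L = (THE z. affine_lift z \<in> L)"

text \<open>The differential of a map \<open>\<phi>\<close> into \<open>CH2\<close>. Under the identification of the tangent space at
  \<open>[p]\<close> with the space of linear maps \<open>\<complex>p \<rightarrow> p\<^sup>\<bottom>\<close>, the velocity of a curve \<open>[p(t)]\<close> is the linear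
  map sending \<open>p(t)\<close> to the component of \<open>p'(t)\<close> orthogonal to \<open>p(t)\<close>. It is computed with the lift
  \<open>P\<close> normalised by \<open>P(u)\<^sub>0 = 1\<close>, so that \<open>q = q\<^sub>0 P(u)\<close> for every \<open>q\<close> in the line \<open>\<phi>(u)\<close>.\<close>

definition diff_CH2 ::
  "('a::euclidean_space \<Rightarrow> (complex ^ 3) set) \<Rightarrow> 'a \<Rightarrow> 'a \<Rightarrow> complex ^ 3 \<Rightarrow> complex ^ 3" where
  "diff_CH2 \<phi> u v =
     (let P = (\<lambda>x. affine_lift (affine_coord (\<phi> x)))
      in (\<lambda>q. if q \<in> \<phi> u then q $ 0 *s perp_proj (P u) (frechet_derivative P (at u) v) else 0))"

definition pullback_metric ::
  "('a::euclidean_space \<Rightarrow> (complex ^ 3) set) \<Rightarrow> 'a \<Rightarrow> 'a \<Rightarrow> 'a \<Rightarrow> real" where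
  "pullback_metric \<phi> u v w = riem_CH2 (\<phi> u) (diff_CH2 \<phi> u v) (diff_CH2 \<phi> u w)"


subsection \<open>Submanifolds\<close>

text \<open>A submanifold is a subset with a manifold structure for which the inclusion is an injective
  smooth immersion (embedded submanifolds are a special case). The structure is given by a countable
  set of smoothly compatible local parametrisations \<open>(U, \<phi>)\<close>, \<open>\<phi> : U \<rightarrow> S\<close>, with \<open>U\<close> open in the
  model space \<open>'a\<close>; its real dimension is \<open>DIM('a)\<close>. The topology of \<open>S\<close> is the one for which the
  \<open>\<phi>(U)\<close> are open and the \<open>\<phi>\<close> are homeomorphisms; it refines the subspace topology and hence is
  Hausdorff, and it is second countable because the atlas is countable.\<close>

type_synonym 'a atlas = "('a set \<times> ('a \<Rightarrow> (complex ^ 3) set)) set"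

definition local_param :: "'a::euclidean_space set \<Rightarrow> ('a \<Rightarrow> (complex ^ 3) set) \<Rightarrow> bool" where
  "local_param U \<phi> \<longleftrightarrow>
     open U \<and> \<phi> ` U \<subseteq> CH2 \<and> inj_on \<phi> U \<and> smooth_on U (\<lambda>u. affine_coord (\<phi> u)) \<and>
     (\<forall>u\<in>U. inj (frechet_derivative (\<lambda>u. affine_coord (\<phi> u)) (at u)))"

definition compatible_params ::
  "'a::euclidean_space set \<times> ('a \<Rightarrow> (complex ^ 3) set) \<Rightarrow>
   'a set \<times> ('a \<Rightarrow> (complex ^ 3) set) \<Rightarrow> bool" where
  "compatible_params = (\<lambda>(U, \<phi>) (V, \<psi>).
     let W = {u \<in> U. \<phi> u \<in> \<psi> ` V} in open W \<and> smooth_on W (\<lambda>u. inv_into V \<psi> (\<phi> u)))"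

definition submanifold_CH2 :: "(complex ^ 3) set set \<Rightarrow> 'a::euclidean_space atlas \<Rightarrow> bool" where
  "submanifold_CH2 S A \<longleftrightarrow>
     countable A \<and>
     S = (\<Union>(U, \<phi>)\<in>A. \<phi> ` U) \<and>
     (\<forall>(U, \<phi>)\<in>A. local_param U \<phi>) \<and>
     (\<forall>c\<in>A. \<forall>d\<in>A. compatible_params c d)"

definition tangent_sub ::
  "'a::euclidean_space atlas \<Rightarrow> (complex ^ 3) set \<Rightarrow> (complex ^ 3 \<Rightarrow> complex ^ 3) set" where
  "tangent_sub A p = {diff_CH2 \<phi> u v | U \<phi> u v. (U, \<phi>) \<in> A \<and> u \<in> U \<and> \<phi> u = p}"

definition CH2_atlas :: "(complex ^ 2) atlas" where
  "CH2_atlas = {({z. Re (herm (affine_lift z) (affine_lift z)) < 0}, \<lambda>z. cline (affine_lift z))}"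


subsection \<open>Geodesics\<close>

text \<open>For a Riemannian metric \<open>G\<close> on an open subset of a Euclidean space, \<open>christoffel G x u v w\<close>
  is \<open>G\<close> applied to \<open>\<nabla>\<^sub>u v\<close> and \<open>w\<close> at \<open>x\<close>, for constant vector fields \<open>u\<close>, \<open>v\<close>, \<open>w\<close>, where \<open>\<nabla>\<close>
  is the Levi-Civita connection (Koszul formula). On basis vectors these are the Christoffel symbols
  of the first kind. The last conjunct of \<open>metric_geodesic\<close> says that \<open>\<nabla>\<^bsub>c'\<^esub> c' = 0\<close>.\<close>

definition christoffel ::
  "('a::euclidean_space \<Rightarrow> 'a \<Rightarrow> 'a \<Rightarrow> real) \<Rightarrow> 'a \<Rightarrow> 'a \<Rightarrow> 'a \<Rightarrow> 'a \<Rightarrow> real" where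
  "christoffel G x u v w =
     (frechet_derivative (\<lambda>y. G y v w) (at x) u +
      frechet_derivative (\<lambda>y. G y u w) (at x) v -
      frechet_derivative (\<lambda>y. G y u v) (at x) w) / 2"

definition metric_geodesic ::
  "('a::euclidean_space \<Rightarrow> 'a \<Rightarrow> 'a \<Rightarrow> real) \<Rightarrow> real set \<Rightarrow> (real \<Rightarrow> 'a) \<Rightarrow> bool" where
  "metric_geodesic G J c \<longleftrightarrow>
     (\<exists>c' c''. \<forall>t\<in>J.
        (c has_vector_derivative c' t) (at t) \<and>
        (c' has_vector_derivative c'' t) (at t) \<and>
        (\<forall>w. G (c t) (c'' t) w + christoffel G (c t) (c' t) (c' t) w = 0))"

text \<open>A geodesic, for the Riemannian metric induced from \<open>CH2\<close>, of the manifold with atlas \<open>A\<close>: in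
  local coordinates it satisfies the geodesic equation. The equation is invariant under changes of
  coordinates, so it suffices to have it in some chart around each parameter value.\<close>

definition geodesic_in :: "'a::euclidean_space atlas \<Rightarrow> real set \<Rightarrow> (real \<Rightarrow> (complex ^ 3) set) \<Rightarrow> bool"
  where "geodesic_in A I \<gamma> \<longleftrightarrow>
    (\<forall>t\<in>I. \<exists>(U, \<phi>)\<in>A. \<exists>J x. open J \<and> t \<in> J \<and> J \<subseteq> I \<and> x ` J \<subseteq> U \<and>
       (\<forall>s\<in>J. \<gamma> s = \<phi> (x s)) \<and> metric_geodesic (pullback_metric \<phi>) J x)"

definition totally_geodesic :: "'a::euclidean_space atlas \<Rightarrow> bool" where
  "totally_geodesic A \<longleftrightarrow>
     (\<forall>I \<gamma>. open I \<and> is_interval I \<and> geodesic_in A I \<gamma> \<longrightarrow> geodesic_in CH2_atlas I \<gamma>)"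

text \<open>Completeness of the induced Riemannian metric: the exponential map is defined on every tangent
  space, that is, every tangent vector is the initial velocity of a geodesic defined on all of
  \<open>\<real>\<close>.\<close>

definition complete_submanifold ::
  "(complex ^ 3) set set \<Rightarrow> 'a::euclidean_space atlas \<Rightarrow> bool" where
  "complete_submanifold S A \<longleftrightarrow>
     (\<forall>p\<in>S. \<forall>\<xi>\<in>tangent_sub A p.
        \<exists>\<gamma>. geodesic_in A UNIV \<gamma> \<and> \<gamma> 0 = p \<and> diff_CH2 \<gamma> 0 1 = \<xi>)"


subsection \<open>Consistency of the definitions\<close>

lemma affine_lift_nth [simp]:
  "affine_lift z $ 0 = 1" "affine_lift z $ 1 = z $ 1" "affine_lift z $ 2 = z $ 2"
  by (simp_all add: affine_lift_def)

lemma all_3: "(\<forall>i::3. P i) \<longleftrightarrow> P 0 \<and> P 1 \<and> P 2"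
proof -
  have "(3::3) = 0" by simp
  then show ?thesis by (metis forall_3)
qed

lemma affine_coord_cline: "affine_coord (cline (affine_lift z)) = z"
proof -
  have "w = z" if "affine_lift w \<in> cline (affine_lift z)" for w
  proof -
    from that obtain c where c: "affine_lift w = c *s affine_lift z"
      by (auto simp: cline_def)
    have "c = 1"
      using arg_cong[OF c, of "\<lambda>v. v $ 0"] by simp
    then show ?thesis
      using arg_cong[OF c, of "\<lambda>v. v $ 1"] arg_cong[OF c, of "\<lambda>v. v $ 2"]
      by (simp add: vec_eq_iff forall_2)
  qed
  moreover have "affine_lift z \<in> cline (affine_lift z)"
    by (auto simp: cline_def intro: range_eqI[of _ _ 1])
  ultimately show ?thesis
    unfolding affine_coord_def by blast
qed

lemma cline_eq_affine:
  assumes "p $ 0 \<noteq> 0"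
  shows "cline p = cline (affine_lift (\<chi> i. if i = 1 then p $ 1 / p $ 0 else p $ 2 / p $ 0))"
    (is "_ = cline ?q")
proof -
  have p: "p = p $ 0 *s ?q"
    using assms by (simp add: vec_eq_iff all_3)
  have "c *s p \<in> cline ?q" for c
    by (subst p) (auto simp: cline_def vector_smult_assoc)
  moreover have "c *s ?q \<in> cline p" for c
  proof -
    have "c *s ?q = (c / p $ 0) *s p"
      using assms by (subst (4) p) (simp add: vector_smult_assoc)
    then show ?thesis by (auto simp: cline_def)
  qed
  ultimately show ?thesis
    by (auto simp: cline_def)
qed

lemma herm_scale: "herm (a *s x) (b *s y) = a * cnj b * herm x y"
  "herm (a *s x) y = a * herm x y" "herm x (b *s y) = cnj b * herm x y"
  by (simp_all add: herm_def algebra_simps)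

lemma CH2_eq_chart:
  "CH2 = (\<lambda>z. cline (affine_lift z)) ` {z. Re (herm (affine_lift z) (affine_lift z)) < 0}"
proof (intro set_eqI iffI)
  fix L assume "L \<in> CH2"
  then obtain p where p: "L = cline p" "Re (herm p p) < 0"
    by (auto simp: CH2_def)
  have "p $ 0 \<noteq> 0"
  proof
    assume "p $ 0 = 0"
    then have "Re (herm p p) = (cmod (p $ 1))\<^sup>2 + (cmod (p $ 2))\<^sup>2"
      by (simp add: herm_def flip: complex_norm_square)
    with p(2) show False
      by (smt (verit) zero_le_power2)
  qed
  define z :: "complex ^ 2" where "z = (\<chi> i. if i = 1 then p $ 1 / p $ 0 else p $ 2 / p $ 0)"
  have L: "L = cline (affine_lift z)"
    using cline_eq_affine[OF \<open>p $ 0 \<noteq> 0\<close>] p(1) by (simp add: z_def)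
  have "p = p $ 0 *s affine_lift z"
    using \<open>p $ 0 \<noteq> 0\<close> by (simp add: vec_eq_iff all_3 z_def)
  then have "herm p p = of_real ((cmod (p $ 0))\<^sup>2) * herm (affine_lift z) (affine_lift z)"
    unfolding complex_norm_square
    by (smt (verit) herm_scale)
  then have "Re (herm (affine_lift z) (affine_lift z)) < 0"
    using p(2) by (simp add: mult_less_0_iff)
  with L show "L \<in> (\<lambda>z. cline (affine_lift z)) ` {z. Re (herm (affine_lift z) (affine_lift z)) < 0}"
    by blast
next
  fix L assume "L \<in> (\<lambda>z. cline (affine_lift z)) ` {z. Re (herm (affine_lift z) (affine_lift z)) < 0}"
  then obtain z where z: "L = cline (affine_lift z)" "Re (herm (affine_lift z) (affine_lift z)) < 0"
    by blast
  have "affine_lift z \<noteq> 0"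
    using affine_lift_nth(1)[of z] by (metis zero_index zero_neq_one)
  with z show "L \<in> CH2" by (auto simp: CH2_def)
qed

lemma tangent_herm_eq:
  assumes L: "L = cline p" "p \<noteq> 0" and t: "t\<^sub>1 \<in> tangent_CH2 L" "t\<^sub>2 \<in> tangent_CH2 L"
  shows "tangent_herm L t\<^sub>1 t\<^sub>2 = - herm (t\<^sub>1 p) (t\<^sub>2 p) / herm p p"
proof -
  define q where "q = (SOME q. q \<in> L \<and> q \<noteq> 0)"
  have pL: "p \<in> L"
    using L by (auto simp: cline_def intro: range_eqI[of _ _ 1])
  have "q \<in> L \<and> q \<noteq> 0"
    unfolding q_def by (rule someI[of _ p]) (use pL L in auto)
  then obtain c where c: "q = c *s p" "c \<noteq> 0"
    using L by (auto simp: cline_def)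
  have "t\<^sub>1 q = c *s t\<^sub>1 p" "t\<^sub>2 q = c *s t\<^sub>2 p"
    using t pL c by (auto simp: tangent_CH2_def)
  then show ?thesis
    using c by (simp add: tangent_herm_def Let_def herm_scale flip: q_def)
qed

lemma diff_CH2_tangent:
  assumes "\<phi> u \<in> CH2"
  shows "diff_CH2 \<phi> u v \<in> tangent_CH2 (\<phi> u)"
proof -
  obtain z where z: "\<phi> u = cline (affine_lift z)" "Re (herm (affine_lift z) (affine_lift z)) < 0"
    using assms by (auto simp: CH2_eq_chart)
  define X where
    "X = perp_proj (affine_lift z)
           (frechet_derivative (\<lambda>x. affine_lift (affine_coord (\<phi> x))) (at u) v)"
  have X: "herm X (affine_lift z) = 0"
  proof -
    have "herm (affine_lift z) (affine_lift z) \<noteq> 0"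
      using z(2) by auto
    moreover have "herm (x - c *s y) w = herm x w - c * herm y w" for x y w c
      by (simp add: herm_def algebra_simps)
    ultimately show ?thesis
      by (simp add: X_def perp_proj_def)
  qed
  have d: "diff_CH2 \<phi> u v = (\<lambda>q. if q \<in> cline (affine_lift z) then q $ 0 *s X else 0)"
    unfolding diff_CH2_def Let_def z(1) affine_coord_cline X_def ..
  have add: "p + q \<in> cline y" if pq: "p \<in> cline y" "q \<in> cline y" for p q y
  proof -
    from pq obtain a b where "p = a *s y" "q = b *s y" by (auto simp: cline_def)
    then have "p + q = (a + b) *s y" by (simp add: vector_sadd_rdistrib)
    then show ?thesis unfolding cline_def by (rule range_eqI)
  qed
  have scale: "c *s p \<in> cline y" if "p \<in> cline y" for p y c
    using that by (auto simp: cline_def vector_smult_assoc)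
  have orth: "herm (a *s X) q = 0" if "q \<in> cline (affine_lift z)" for a q
    using that X by (auto simp: cline_def herm_scale)
  show ?thesis
    unfolding d z(1) tangent_CH2_def
    by (simp add: add scale orth vector_sadd_rdistrib vector_smult_assoc)
qed

lemma smooth_on_ident: "smooth_on U (\<lambda>x. x)"
proof -
  have const: "times_differentiable_on k U (\<lambda>x. c)" for k and c :: 'a
    by (induction k arbitrary: c) auto
  have "times_differentiable_on k U (\<lambda>x. x)" for k
    by (cases k) (auto simp: const)
  then show ?thesis by (simp add: smooth_on_def)
qed

lemma smooth_on_cong:
  assumes "\<And>x. x \<in> U \<Longrightarrow> f x = g x" "open U" "smooth_on U f"
  shows "smooth_on U g"
proof -
  have *: "times_differentiable_on k U g"
    if "\<And>x. x \<in> U \<Longrightarrow> f x = g x" "times_differentiable_on k U f" for k and f g :: "'a \<Rightarrow> 'b"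
    using that
  proof (induction k arbitrary: f g)
    case 0
    then show ?case by (auto cong: continuous_on_cong)
  next
    case (Suc k)
    have D: "(g has_derivative frechet_derivative f (at x)) (at x)" if "x \<in> U" for x
      using has_derivative_transform_within_open[OF _ \<open>open U\<close> that] Suc.prems that
      by (metis frechet_derivative_works times_differentiable_on.simps(2))
    have eq: "frechet_derivative f (at x) = frechet_derivative g (at x)" if "x \<in> U" for x
      using frechet_derivative_at[OF D[OF that]] .
    have "times_differentiable_on k U (\<lambda>x. frechet_derivative g (at x) v)" for v
    proof (rule Suc.IH[of "\<lambda>x. frechet_derivative f (at x) v"])
      show "times_differentiable_on k U (\<lambda>x. frechet_derivative f (at x) v)"
        using Suc.prems(2) by simp
    qed (simp add: eq)
    moreover have "g differentiable (at x)" if "x \<in> U" for x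
      using D[OF that] by (rule differentiableI)
    ultimately show ?case by simp
  qed
  show ?thesis
    using *[of f g] assms(1,3) unfolding smooth_on_def by blast
qed

lemma submanifold_CH2_atlas: "submanifold_CH2 CH2 CH2_atlas"
proof -
  let ?B = "{z. Re (herm (affine_lift z) (affine_lift z)) < 0}"
  let ?f = "\<lambda>z. cline (affine_lift z)"
  have "open ?B"
    by (auto simp: herm_def intro!: open_Collect_less continuous_intros)
  have inj: "inj ?f"
    by (rule inj_on_inverseI[of _ affine_coord]) (simp add: affine_coord_cline)
  have "inj_on ?f ?B"
    using inj by (rule inj_on_subset) auto
  then have "local_param ?B ?f"
    using \<open>open ?B\<close> by (auto simp: local_param_def affine_coord_cline CH2_eq_chart smooth_on_ident)
  moreover have "compatible_params (?B, ?f) (?B, ?f)"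
  proof -
    have W: "{u \<in> ?B. ?f u \<in> ?f ` ?B} = ?B" by auto
    have "smooth_on ?B (\<lambda>u. inv_into ?B ?f (?f u))"
      by (rule smooth_on_cong[OF _ \<open>open ?B\<close> smooth_on_ident])
        (metis (mono_tags, lifting) \<open>inj_on ?f ?B\<close> inv_into_f_f)
    then show ?thesis
      unfolding compatible_params_def Let_def case_prod_conv W using \<open>open ?B\<close> by blast
  qed
  ultimately show ?thesis
    by (auto simp: submanifold_CH2_def CH2_atlas_def CH2_eq_chart)
qed

end

theory Submission
  imports Defs
begin

text \<open>In the affine chart the geodesics of the complex hyperbolic plane are the solutions of
  \<open>y'' = - 2\<langle>y', y\<rangle>/(1 - |y|\<^sup>2) y'\<close>. Completeness provides a geodesic of the submanifold in every
  direction at every point, so in a local parametrisation \<open>f\<close> every vector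
  \<open>D\<^sup>2f(v, v) + 2\<langle>Df v, f\<rangle>/(1 - |f|\<^sup>2) Df v\<close> is tangent, i.e. the second fundamental form vanishes.
  The tangent space of a real hypersurface contains a unique complex line; let \<open>m\<close> be the spanning
  vector \<open>line_vec\<close> of it, a polynomial in the first derivatives of \<open>f\<close>. Vanishing of the second fundamental
  form, differentiated once, amounts to \<open>det(m, D\<^sub>w m) = det(D\<^sub>w f, m) k\<close> for all \<open>w\<close>, where
  \<open>k = \<langle>m, f\<rangle>/(1 - |f|\<^sup>2)\<close>. Its integrability condition in a direction \<open>v\<close> with \<open>D\<^sub>v f = m\<close> and a
  direction \<open>w\<close> with \<open>det(D\<^sub>w f, m) \<noteq> 0\<close> is \<open>D\<^sub>v k = l k + k\<^sup>2\<close>, where \<open>D\<^sub>v m = l m\<close>; but computing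
  \<open>D\<^sub>v k\<close> directly gives \<open>l k + k\<^sup>2 + |m|\<^sup>2/(1 - |f|\<^sup>2) + |k|\<^sup>2\<close>.\<close>

subsection \<open>Iterated directional derivatives\<close>

abbreviation dir_deriv :: "'a::euclidean_space \<Rightarrow> ('a \<Rightarrow> 'b::euclidean_space) \<Rightarrow> 'a \<Rightarrow> 'b" where
  "dir_deriv v f \<equiv> \<lambda>x. frechet_derivative f (at x) v"

text \<open>Derivative formulas are available only at points of \<open>U\<close>, and the inductions
  on \<open>k\<close> below must trade a derivative for such a formula; on an open set, agreement
  passes to derivatives.\<close>

lemma times_differentiable_on_cong:
  assumes "open U" "times_differentiable_on k U f" "\<And>x. x \<in> U \<Longrightarrow> f x = g x"
  shows "times_differentiable_on k U g"
  using assms(2,3)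
proof (induction k arbitrary: f g)
  case 0
  then show ?case by (auto cong: continuous_on_cong)
next
  case (Suc k)
  have D: "(g has_derivative frechet_derivative f (at x)) (at x)" if "x \<in> U" for x
    using has_derivative_transform_within_open[OF _ \<open>open U\<close> that] Suc.prems that
    by (metis frechet_derivative_works times_differentiable_on.simps(2))
  have eq: "frechet_derivative f (at x) = frechet_derivative g (at x)" if "x \<in> U" for x
    using frechet_derivative_at[OF D[OF that]] .
  have "times_differentiable_on k U (dir_deriv v g)" for v
    by (rule Suc.IH[of "dir_deriv v f"]) (use Suc.prems eq in auto)
  with D show ?case by (auto intro: differentiableI)
qed

lemma times_differentiable_on_Suc_imp:
  "times_differentiable_on (Suc k) U f \<Longrightarrow> times_differentiable_on k U f"
proof (induction k arbitrary: f)
  case 0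
  then show ?case
    by (auto intro!: continuous_at_imp_continuous_on differentiable_imp_continuous_within)
next
  case (Suc k)
  then show ?case by (metis times_differentiable_on.simps(2))
qed

lemma times_differentiable_on_add:
  assumes "open U" "times_differentiable_on k U f" "times_differentiable_on k U g"
  shows "times_differentiable_on k U (\<lambda>x. f x + g x)"
  using assms(2,3)
proof (induction k arbitrary: f g)
  case 0
  then show ?case by (auto intro: continuous_intros)
next
  case (Suc k)
  have D: "((\<lambda>x. f x + g x) has_derivative (\<lambda>v. dir_deriv v f x + dir_deriv v g x)) (at x)"
    if "x \<in> U" for x
    using Suc.prems that by (auto simp: frechet_derivative_works intro!: has_derivative_add)
  have "times_differentiable_on k U (dir_deriv v (\<lambda>x. f x + g x))" for v
    by (rule times_differentiable_on_cong[OF \<open>open U\<close> Suc.IH[of "dir_deriv v f" "dir_deriv v g"]])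
      (use Suc.prems frechet_derivative_at[OF D] in \<open>auto dest: fun_cong\<close>)
  with D show ?case by (auto intro: differentiableI)
qed

lemma times_differentiable_on_bounded_linear:
  assumes "open U" "bounded_linear h" "times_differentiable_on k U f"
  shows "times_differentiable_on k U (\<lambda>x. h (f x))"
  using assms(3)
proof (induction k arbitrary: f)
  case 0
  then show ?case by (auto intro: bounded_linear.continuous_on[OF \<open>bounded_linear h\<close>])
next
  case (Suc k)
  have D: "((\<lambda>x. h (f x)) has_derivative (\<lambda>v. h (dir_deriv v f x))) (at x)"
    if "x \<in> U" for x
    using Suc.prems that
    by (auto simp: frechet_derivative_works intro!: bounded_linear.has_derivative[OF \<open>bounded_linear h\<close>])
  have "times_differentiable_on k U (dir_deriv v (\<lambda>x. h (f x)))" for v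
    by (rule times_differentiable_on_cong[OF \<open>open U\<close> Suc.IH[of "dir_deriv v f"]])
      (use Suc.prems frechet_derivative_at[OF D] in \<open>auto dest: fun_cong\<close>)
  with D show ?case by (auto intro: differentiableI)
qed

text \<open>In the Leibniz rule each summand keeps one factor undifferentiated, whence the use of
  \<open>times_differentiable_on_Suc_imp\<close>. Arbitrary real bilinear \<open>p\<close> covers
  scalar multiples, determinants and Hermitian products alike.\<close>

lemma times_differentiable_on_bounded_bilinear:
  assumes "open U" "bounded_bilinear p" "times_differentiable_on k U f" "times_differentiable_on k U g"
  shows "times_differentiable_on k U (\<lambda>x. p (f x) (g x))"
  using assms(3,4)
proof (induction k arbitrary: f g)
  case 0
  then show ?case by (auto intro: bounded_bilinear.continuous_on[OF \<open>bounded_bilinear p\<close>])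
next
  case (Suc k)
  have D: "((\<lambda>x. p (f x) (g x)) has_derivative
      (\<lambda>v. p (f x) (dir_deriv v g x) + p (dir_deriv v f x) (g x))) (at x)"
    if "x \<in> U" for x
    using Suc.prems that
    by (auto simp: frechet_derivative_works intro!: bounded_bilinear.FDERIV[OF \<open>bounded_bilinear p\<close>])
  have "times_differentiable_on k U (dir_deriv v (\<lambda>x. p (f x) (g x)))" for v
    by (rule times_differentiable_on_cong[OF \<open>open U\<close> times_differentiable_on_add[OF \<open>open U\<close>
          Suc.IH[of "f" "dir_deriv v g"] Suc.IH[of "dir_deriv v f" "g"]]])
      (use Suc.prems frechet_derivative_at[OF D] times_differentiable_on_Suc_imp[of k U] in
        \<open>auto dest: fun_cong simp del: times_differentiable_on.simps(1)\<close>)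
  with D show ?case by (auto intro: differentiableI)
qed

lemma smooth_on_dir_deriv: "smooth_on U f \<Longrightarrow> smooth_on U (dir_deriv v f)"
  unfolding smooth_on_def by (metis times_differentiable_on.simps(2))

lemma smooth_on_has_derivative:
  "smooth_on U f \<Longrightarrow> x \<in> U \<Longrightarrow> (f has_derivative frechet_derivative f (at x)) (at x)"
  unfolding smooth_on_def frechet_derivative_works[symmetric] by (metis times_differentiable_on.simps(2))

lemma smooth_on_bounded_linear:
  "open U \<Longrightarrow> bounded_linear h \<Longrightarrow> smooth_on U f \<Longrightarrow> smooth_on U (\<lambda>x. h (f x))"
  by (simp add: smooth_on_def times_differentiable_on_bounded_linear)

lemma smooth_on_add:
  "open U \<Longrightarrow> smooth_on U f \<Longrightarrow> smooth_on U g \<Longrightarrow> smooth_on U (\<lambda>x. f x + g x)"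
  by (simp add: smooth_on_def times_differentiable_on_add)

lemma smooth_on_diff:
  assumes "open U" "smooth_on U f" "smooth_on U g"
  shows "smooth_on U (\<lambda>x. f x - g x)"
  using smooth_on_add[OF assms(1,2) smooth_on_bounded_linear[OF assms(1) _ assms(3), of uminus]]
  by (simp add: bounded_linear_minus bounded_linear_ident)

lemma smooth_on_bounded_bilinear:
  "open U \<Longrightarrow> bounded_bilinear p \<Longrightarrow> smooth_on U f \<Longrightarrow> smooth_on U g \<Longrightarrow>
    smooth_on U (\<lambda>x. p (f x) (g x))"
  by (simp add: smooth_on_def times_differentiable_on_bounded_bilinear)

lemma smooth_on_continuous: "smooth_on U f \<Longrightarrow> continuous_on U f"
  unfolding smooth_on_def by (metis times_differentiable_on.simps(1))

text \<open>Both iterated derivatives are limits of the second difference quotient, by applying the mean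
  value theorem in each of the two directions.\<close>

lemma second_difference:
  fixes f :: "'a::euclidean_space \<Rightarrow> real"
  assumes f: "smooth_on U f" and h: "h > 0"
    and U: "\<And>s t. 0 \<le> s \<Longrightarrow> s \<le> h \<Longrightarrow> 0 \<le> t \<Longrightarrow> t \<le> h \<Longrightarrow> x + s *\<^sub>R v + t *\<^sub>R w \<in> U"
  shows "\<exists>s t. 0 < s \<and> s < h \<and> 0 < t \<and> t < h \<and>
    f (x + h *\<^sub>R v + h *\<^sub>R w) - f (x + h *\<^sub>R v) - f (x + h *\<^sub>R w) + f x
      = h * h * dir_deriv w (dir_deriv v f) (x + s *\<^sub>R v + t *\<^sub>R w)"
proof -
  have D: "(g has_derivative frechet_derivative g (at (x + s *\<^sub>R v + t *\<^sub>R w)))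
      (at (x + s *\<^sub>R v + t *\<^sub>R w))"
    if "smooth_on U g" "0 \<le> s" "s \<le> h" "0 \<le> t" "t \<le> h" for s t and g :: "'a \<Rightarrow> real"
    by (rule smooth_on_has_derivative) (use that U in auto)
  have Dv: "((\<lambda>s. f (x + s *\<^sub>R v + t *\<^sub>R w)) has_real_derivative
      dir_deriv v f (x + s *\<^sub>R v + t *\<^sub>R w)) (at s)"
    if "0 \<le> s" "s \<le> h" "0 \<le> t" "t \<le> h" for s t
    unfolding has_field_derivative_def
    by (rule has_derivative_eq_rhs,
        rule has_derivative_compose[where f = "\<lambda>s. x + s *\<^sub>R v + t *\<^sub>R w", OF _ D[OF f that]])
      (auto intro!: derivative_eq_intros ext
        simp: linear_scale[OF bounded_linear.linear[OF has_derivative_bounded_linear[OF D[OF f that]]]])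
  have sv: "smooth_on U (dir_deriv v f)" using f by (rule smooth_on_dir_deriv)
  have Dw: "((\<lambda>t. dir_deriv v f (x + s *\<^sub>R v + t *\<^sub>R w)) has_real_derivative
      dir_deriv w (dir_deriv v f) (x + s *\<^sub>R v + t *\<^sub>R w)) (at t)"
    if "0 \<le> s" "s \<le> h" "0 \<le> t" "t \<le> h" for s t
    unfolding has_field_derivative_def
    by (rule has_derivative_eq_rhs,
        rule has_derivative_compose[where f = "\<lambda>t. x + s *\<^sub>R v + t *\<^sub>R w", OF _ D[OF sv that]])
      (auto intro!: derivative_eq_intros ext
        simp: linear_scale[OF bounded_linear.linear[OF has_derivative_bounded_linear[OF D[OF sv that]]]])
  \<comment> \<open>Mean value theorem in \<open>s\<close> for the difference of \<open>f\<close>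
    between \<open>t = h\<close> and \<open>t = 0\<close>; the zero multiples are kept so that the
    terms match \<open>MVT2\<close>.\<close>
  have "\<exists>s. 0 < s \<and> s < h \<and>
      (f (x + h *\<^sub>R v + h *\<^sub>R w) - f (x + h *\<^sub>R v + 0 *\<^sub>R w)) - (f (x + 0 *\<^sub>R v + h *\<^sub>R w) - f (x + 0 *\<^sub>R v + 0 *\<^sub>R w))
      = (h - 0) * (dir_deriv v f (x + s *\<^sub>R v + h *\<^sub>R w) - dir_deriv v f (x + s *\<^sub>R v + 0 *\<^sub>R w))"
    by (rule MVT2[of 0 h "\<lambda>s. f (x + s *\<^sub>R v + h *\<^sub>R w) - f (x + s *\<^sub>R v + 0 *\<^sub>R w)"
      "\<lambda>s. dir_deriv v f (x + s *\<^sub>R v + h *\<^sub>R w) - dir_deriv v f (x + s *\<^sub>R v + 0 *\<^sub>R w)"])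
      (use h in \<open>auto intro!: DERIV_diff Dv Dv[of _ 0, simplified]\<close>)
  then obtain s where s: "0 < s" "s < h" and 1:
      "(f (x + h *\<^sub>R v + h *\<^sub>R w) - f (x + h *\<^sub>R v + 0 *\<^sub>R w)) - (f (x + 0 *\<^sub>R v + h *\<^sub>R w) - f (x + 0 *\<^sub>R v + 0 *\<^sub>R w))
      = (h - 0) * (dir_deriv v f (x + s *\<^sub>R v + h *\<^sub>R w) - dir_deriv v f (x + s *\<^sub>R v + 0 *\<^sub>R w))"
    by blast
  have "\<exists>t. 0 < t \<and> t < h \<and>
      dir_deriv v f (x + s *\<^sub>R v + h *\<^sub>R w) - dir_deriv v f (x + s *\<^sub>R v + 0 *\<^sub>R w)
      = (h - 0) * dir_deriv w (dir_deriv v f) (x + s *\<^sub>R v + t *\<^sub>R w)"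
    by (rule MVT2) (use h s Dw in auto)
  then obtain t where "0 < t" "t < h" and 2:
      "dir_deriv v f (x + s *\<^sub>R v + h *\<^sub>R w) - dir_deriv v f (x + s *\<^sub>R v + 0 *\<^sub>R w)
      = (h - 0) * dir_deriv w (dir_deriv v f) (x + s *\<^sub>R v + t *\<^sub>R w)"
    by blast
  with s 1[unfolded 2] show ?thesis by (intro exI[of _ s] exI[of _ t]) (auto simp: algebra_simps)
qed

lemma dir_deriv_commute_real:
  fixes f :: "'a::euclidean_space \<Rightarrow> real"
  assumes f: "smooth_on U f" and U: "open U" "x \<in> U"
  shows "dir_deriv w (dir_deriv v f) x = dir_deriv v (dir_deriv w f) x"
proof (rule ccontr)
  let ?p = "dir_deriv w (dir_deriv v f)" and ?q = "dir_deriv v (dir_deriv w f)"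
  \<comment> \<open>Half the gap, so no number lies within \<open>e\<close> of both values; yet at
    suitable points near \<open>x\<close> the two iterated derivatives take a common value.\<close>
  define e where "e = dist (?p x) (?q x) / 2"
  assume "?p x \<noteq> ?q x"
  then have e: "e > 0" by (simp add: e_def)
  have "isCont ?p x" "isCont ?q x"
    using U smooth_on_continuous smooth_on_dir_deriv f by (metis continuous_on_eq_continuous_at)+
  then obtain d1 d2 where d1: "d1 > 0" "\<And>y. dist y x < d1 \<Longrightarrow> dist (?p y) (?p x) < e"
    and d2: "d2 > 0" "\<And>y. dist y x < d2 \<Longrightarrow> dist (?q y) (?q x) < e"
    using e unfolding continuous_at_eps_delta by metis
  obtain d3 where d3: "d3 > 0" "ball x d3 \<subseteq> U"
    using U open_contains_ball by blast
  define d where "d = Min {d1, d2, d3}"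
  have d: "d > 0" "d \<le> d1" "d \<le> d2" "d \<le> d3" using d1 d2 d3 by (auto simp: d_def)
  \<comment> \<open>Keeps the parallelogram with sides \<open>h v\<close> and \<open>h w\<close>
    within distance \<open>d\<close> of \<open>x\<close>; adding 1 avoids a zero
    denominator.\<close>
  define h where "h = d / (2 * (norm v + norm w + 1))"
  have pos: "norm v + norm w + 1 > 0" by (smt (verit) norm_ge_zero)
  have h: "h > 0" using d pos by (simp add: h_def)
  have close: "dist (x + s *\<^sub>R v + t *\<^sub>R w) x < d" if "0 \<le> s" "s \<le> h" "0 \<le> t" "t \<le> h" for s t
  proof -
    have "norm (s *\<^sub>R v + t *\<^sub>R w) \<le> s * norm v + t * norm w"
      using norm_triangle_ineq[of "s *\<^sub>R v" "t *\<^sub>R w"] that by simp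
    also have "\<dots> \<le> h * norm v + h * norm w"
      using that by (intro add_mono mult_right_mono) auto
    also have "\<dots> < 2 * (h * (norm v + norm w + 1))"
      using h mult_pos_pos[OF h pos] by (simp add: algebra_simps)
    also have "\<dots> = d" using pos unfolding h_def by (simp del: distrib_left_numeral)
    finally show ?thesis by (simp add: dist_norm add.assoc)
  qed
  have in_U: "x + s *\<^sub>R v + t *\<^sub>R w \<in> U" if "0 \<le> s" "s \<le> h" "0 \<le> t" "t \<le> h" for s t
    using close[OF that] d d3 by (auto simp: dist_commute subset_eq)
  obtain s t where st: "0 < s" "s < h" "0 < t" "t < h" and 1:
    "f (x + h *\<^sub>R v + h *\<^sub>R w) - f (x + h *\<^sub>R v) - f (x + h *\<^sub>R w) + f x
      = h * h * ?p (x + s *\<^sub>R v + t *\<^sub>R w)"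
    using second_difference[OF f h in_U] by blast
  have in_U': "x + s *\<^sub>R w + t *\<^sub>R v \<in> U" if "0 \<le> s" "s \<le> h" "0 \<le> t" "t \<le> h" for s t
    using in_U[OF that(3,4,1,2)] by (simp add: algebra_simps)
  obtain s' t' where st': "0 < s'" "s' < h" "0 < t'" "t' < h" and 2:
    "f (x + h *\<^sub>R w + h *\<^sub>R v) - f (x + h *\<^sub>R w) - f (x + h *\<^sub>R v) + f x
      = h * h * ?q (x + s' *\<^sub>R w + t' *\<^sub>R v)"
    using second_difference[OF f h in_U'] by blast
  have "h * h * ?p (x + s *\<^sub>R v + t *\<^sub>R w) = h * h * ?q (x + t' *\<^sub>R v + s' *\<^sub>R w)"
    using 1 2 by (simp add: algebra_simps)
  then have "?p (x + s *\<^sub>R v + t *\<^sub>R w) = ?q (x + t' *\<^sub>R v + s' *\<^sub>R w)"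
    using h by simp
  moreover have "dist (?p (x + s *\<^sub>R v + t *\<^sub>R w)) (?p x) < e"
    by (rule d1(2)) (use close[of s t] st d in auto)
  moreover have "dist (?q (x + t' *\<^sub>R v + s' *\<^sub>R w)) (?q x) < e"
    by (rule d2(2)) (use close[of t' s'] st' d in auto)
  ultimately show False unfolding e_def dist_real_def by (smt (verit) field_sum_of_halves)
qed

lemma dir_deriv_bounded_linear:
  assumes "bounded_linear h" "f differentiable (at x)"
  shows "dir_deriv v (\<lambda>x. h (f x)) x = h (dir_deriv v f x)"
proof -
  have "((\<lambda>x. h (f x)) has_derivative (\<lambda>v. h (dir_deriv v f x))) (at x)"
    using assms by (auto simp: frechet_derivative_works intro: bounded_linear.has_derivative)
  from frechet_derivative_at[OF this] show ?thesis by metis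
qed

lemma dir_deriv_cong:
  assumes "open U" "x \<in> U" "\<And>y. y \<in> U \<Longrightarrow> f y = g y"
  shows "dir_deriv v f x = dir_deriv v g x"
proof -
  \<comment> \<open>No differentiability is assumed: \<open>frechet_derivative\<close> is a choice
    among all derivatives, so it is enough that \<open>f\<close> and \<open>g\<close> have the same
    ones.\<close>
  have "(f has_derivative f') (at x) \<longleftrightarrow> (g has_derivative f') (at x)" for f'
    using has_derivative_transform_within_open[OF _ assms(1,2)] assms(3) by metis
  then show ?thesis by (simp add: frechet_derivative_def)
qed

text \<open>Pairing with a basis vector is linear and commutes with differentiation, which leaves
  the real-valued case.\<close>

lemma dir_deriv_commute:
  fixes f :: "'a::euclidean_space \<Rightarrow> 'b::euclidean_space"
  assumes f: "smooth_on U f" and U: "open U" "x \<in> U"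
  shows "dir_deriv w (dir_deriv v f) x = dir_deriv v (dir_deriv w f) x"
proof (rule euclidean_eqI)
  fix b :: 'b
  have diff: "g differentiable (at y)" if "smooth_on U g" "y \<in> U" for g :: "'a \<Rightarrow> 'b" and y
    using smooth_on_has_derivative[OF that] differentiableI by blast
  have *: "dir_deriv w (dir_deriv v (\<lambda>x. f x \<bullet> b)) x = dir_deriv w (dir_deriv v f) x \<bullet> b" for v w :: 'a
  proof -
    have "dir_deriv w (dir_deriv v (\<lambda>x. f x \<bullet> b)) x = dir_deriv w (\<lambda>x. dir_deriv v f x \<bullet> b) x"
      by (rule dir_deriv_cong[OF U]) (simp add: dir_deriv_bounded_linear[OF bounded_linear_inner_left] diff f)
    also have "\<dots> = dir_deriv w (dir_deriv v f) x \<bullet> b"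
      by (rule dir_deriv_bounded_linear[OF bounded_linear_inner_left])
        (use U f in \<open>auto intro: diff smooth_on_dir_deriv\<close>)
    finally show ?thesis .
  qed
  show "dir_deriv w (dir_deriv v f) x \<bullet> b = dir_deriv v (dir_deriv w f) x \<bullet> b"
    using dir_deriv_commute_real[OF smooth_on_bounded_linear[OF U(1) bounded_linear_inner_left[of b] f] U, where w = w and v = v]
    by (simp add: *)
qed


subsection \<open>Real hypersurfaces of the complex plane\<close>

definition det2 :: "complex ^ 2 \<Rightarrow> complex ^ 2 \<Rightarrow> complex" where
  "det2 x y = x $ 1 * y $ 2 - x $ 2 * y $ 1"

definition hdot :: "complex ^ 2 \<Rightarrow> complex ^ 2 \<Rightarrow> complex" where
  "hdot x y = x $ 1 * cnj (y $ 1) + x $ 2 * cnj (y $ 2)"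

lemma bounded_bilinear_det2: "bounded_bilinear det2"
  unfolding bilinear_conv_bounded_bilinear[symmetric] bilinear_def
  by (auto intro!: linearI simp: det2_def algebra_simps scaleR_conv_of_real[where 'a = complex])

lemma bounded_bilinear_hdot: "bounded_bilinear hdot"
  unfolding bilinear_conv_bounded_bilinear[symmetric] bilinear_def
  by (auto intro!: linearI simp: hdot_def algebra_simps scaleR_conv_of_real[where 'a = complex])

lemma bounded_bilinear_smult: "bounded_bilinear ((*s) :: complex \<Rightarrow> complex ^ 'n::finite \<Rightarrow> _)"
  unfolding bilinear_conv_bounded_bilinear[symmetric] bilinear_def
  by (auto intro!: linearI simp: vec_eq_iff algebra_simps scaleR_conv_of_real[where 'a = complex])

lemma det2_smult [simp]: "det2 (c *s x) y = c * det2 x y" "det2 x (c *s y) = c * det2 x y"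
  by (simp_all add: det2_def algebra_simps)

lemma hdot_smult [simp]: "hdot (c *s x) y = c * hdot x y" "hdot x (c *s y) = cnj c * hdot x y"
  by (simp_all add: hdot_def algebra_simps)

lemma det2_self [simp]: "det2 x x = 0"
  by (simp add: det2_def)

lemma det2_commute: "det2 x y = - det2 y x"
  by (simp add: det2_def)

lemma cnj_hdot: "cnj (hdot x y) = hdot y x"
  by (simp add: hdot_def)

lemma hdot_self: "hdot x x = complex_of_real ((cmod (x $ 1))\<^sup>2 + (cmod (x $ 2))\<^sup>2)"
  by (simp add: hdot_def complex_norm_square del: of_real_power)

lemma hdot_self_pos: "x \<noteq> 0 \<Longrightarrow> Re (hdot x x) > 0"
  by (auto simp: hdot_self vec_eq_iff forall_2 add_pos_nonneg add_nonneg_pos)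

lemma det2_eq_0:
  assumes "det2 x y = 0" "x \<noteq> 0"
  obtains c where "y = c *s x"
proof (cases "x $ 1 = 0")
  case True
  with assms have "x $ 2 \<noteq> 0" "y $ 1 = 0" by (auto simp: vec_eq_iff forall_2 det2_def)
  with True show ?thesis by (intro that[of "y $ 2 / x $ 2"]) (auto simp: vec_eq_iff forall_2)
next
  case False
  with assms show ?thesis
    by (intro that[of "y $ 1 / x $ 1"]) (auto simp: vec_eq_iff forall_2 det2_def field_simps)
qed

text \<open>For real linearly independent \<open>a\<close>, \<open>b\<close>, \<open>c\<close> the complex line contained in their real span is
  spanned by \<open>line_vec a b c\<close>, and \<open>Re (det2 _ (line_vec a b c))\<close> is a conormal of the span.\<close>

definition line_vec :: "complex ^ 2 \<Rightarrow> complex ^ 2 \<Rightarrow> complex ^ 2 \<Rightarrow> complex ^ 2" where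
  "line_vec a b c = cnj (det2 b c) *s a - cnj (det2 a c) *s b + cnj (det2 a b) *s c"

text \<open>Any three vectors satisfy
  \<open>det2 b c *s a - det2 a c *s b + det2 a b *s c = 0\<close>. Adding this relation to
  \<open>line_vec\<close> turns the conjugated coefficients into real ones; subtracting it and
  multiplying by \<open>\<i>\<close> gives \<open>line_vec_Im\<close>.\<close>

lemma line_vec_Re:
  "line_vec a b c = (2 * Re (det2 b c)) *\<^sub>R a - (2 * Re (det2 a c)) *\<^sub>R b + (2 * Re (det2 a b)) *\<^sub>R c"
proof -
  have *: "complex_of_real (2 * Re z) = z + cnj z" for z
    by (simp add: complex_eq_iff)
  show ?thesis
    unfolding vec_eq_iff line_vec_def vector_add_component vector_minus_component
      vector_scaleR_component scaleR_conv_of_real[where 'a = complex] *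
    by (simp add: forall_2 det2_def algebra_simps)
qed

lemma line_vec_Im:
  "\<i> *s line_vec a b c =
    (2 * Im (det2 b c)) *\<^sub>R a - (2 * Im (det2 a c)) *\<^sub>R b + (2 * Im (det2 a b)) *\<^sub>R c"
proof -
  have *: "complex_of_real (2 * Im z) = \<i> * (cnj z - z)" for z
    by (simp add: complex_eq_iff)
  show ?thesis
    unfolding vec_eq_iff line_vec_def vector_add_component vector_minus_component
      vector_scaleR_component scaleR_conv_of_real[where 'a = complex] *
    by (simp add: forall_2 det2_def algebra_simps)
qed

text \<open>Each of \<open>a\<close>, \<open>b\<close>, \<open>c\<close> pairs with
  \<open>line_vec a b c\<close> to a number minus its conjugate, hence to an imaginary one.\<close>

lemma Re_det2_line_vec:
  "Re (det2 (r *\<^sub>R a + s *\<^sub>R b + t *\<^sub>R c) (line_vec a b c)) = 0"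
  by (simp add: det2_def line_vec_def algebra_simps)

text \<open>If the vector vanished, independence would make all three determinants zero, putting
  \<open>a\<close>, \<open>b\<close>, \<open>c\<close> in one complex line, which has real dimension
  two.\<close>

lemma line_vec_nonzero:
  assumes indep: "\<And>r s t. r *\<^sub>R a + s *\<^sub>R b + t *\<^sub>R c = 0 \<Longrightarrow> r = 0 \<and> s = 0 \<and> t = 0"
  shows "line_vec a b c \<noteq> 0"
proof
  assume 0: "line_vec a b c = 0"
  have "Re (det2 b c) = 0" "Re (det2 a c) = 0" "Re (det2 a b) = 0"
    using indep[of "2 * Re (det2 b c)" "- (2 * Re (det2 a c))" "2 * Re (det2 a b)"]
      line_vec_Re[of a b c] 0 by simp_all
  moreover have "Im (det2 b c) = 0" "Im (det2 a c) = 0" "Im (det2 a b) = 0"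
    using indep[of "2 * Im (det2 b c)" "- (2 * Im (det2 a c))" "2 * Im (det2 a b)"]
      line_vec_Im[of a b c] 0 by simp_all
  ultimately have "det2 a c = 0" "det2 a b = 0" by (simp_all add: complex_eq_iff)
  moreover have "a \<noteq> 0" using indep[of 1 0 0] by auto
  ultimately obtain y z where yz: "b = y *s a" "c = z *s a"
    by (metis det2_eq_0)
  have sc: "r *\<^sub>R x = complex_of_real r *s x" for r and x :: "complex ^ 2"
    by (simp add: vec_eq_iff scaleR_conv_of_real[where 'a = complex])
  \<comment> \<open>A real linear relation between 1, \<open>y\<close> and \<open>z\<close>, with
    the 2 by 2 minors of their real and imaginary parts as coefficients.\<close>
  have eq: "of_real (Im y * Re z - Im z * Re y) + of_real (Im z) * y - of_real (Im y) * z = 0"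
    by (simp add: complex_eq_iff)
  have "(Im y * Re z - Im z * Re y) *\<^sub>R a + Im z *\<^sub>R b + (- Im y) *\<^sub>R c
      = (of_real (Im y * Re z - Im z * Re y) + of_real (Im z) * y - of_real (Im y) * z) *s a"
    by (simp add: yz sc vector_smult_assoc vec_eq_iff algebra_simps)
  also have "\<dots> = 0" unfolding eq by simp
  finally have "Im y = 0" using indep by fastforce
  then have "Re y *\<^sub>R a + (- 1) *\<^sub>R b + 0 *\<^sub>R c = 0"
    using \<open>Im y = 0\<close> by (simp add: yz sc vec_eq_iff complex_eq_iff)
  from indep[OF this] show False by simp
qed

text \<open>Otherwise \<open>a\<close>, \<open>b\<close>, \<open>c\<close> are complex multiples of
  \<open>m\<close>, their mutual determinants vanish, and so does \<open>m\<close>. This supplies a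
  tangent direction outside the complex line.\<close>

lemma line_vec_transverse:
  assumes "line_vec a b c \<noteq> 0"
  shows "det2 a (line_vec a b c) \<noteq> 0 \<or> det2 b (line_vec a b c) \<noteq> 0 \<or> det2 c (line_vec a b c) \<noteq> 0"
proof (rule ccontr)
  define m where "m = line_vec a b c"
  assume "\<not> ?thesis"
  then have "det2 m a = 0" "det2 m b = 0" "det2 m c = 0"
    unfolding m_def by (metis det2_commute neg_equal_0_iff_equal)+
  then obtain x y z where "a = x *s m" "b = y *s m" "c = z *s m"
    using assms m_def by (metis det2_eq_0)
  then have "det2 b c = 0" "det2 a c = 0" "det2 a b = 0" by simp_all
  then have "m = 0" unfolding m_def by (simp add: line_vec_def)
  with assms show False by (simp add: m_def)
qed

text \<open>The local core: the contradiction arises at \<open>u\<close>, from identities on the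
  neighbourhood \<open>U\<close> that can be differentiated there.\<close>

lemma no_totally_geodesic_hypersurface:
  fixes f :: "real ^ 3 \<Rightarrow> complex ^ 2"
  assumes U: "open U" "u \<in> U" and f: "smooth_on U f"
    and inj: "\<And>x. x \<in> U \<Longrightarrow> inj (frechet_derivative f (at x))"
    and ball: "\<And>x. x \<in> U \<Longrightarrow> Re (hdot (f x) (f x)) < 1"
    and geo: "\<And>x v. x \<in> U \<Longrightarrow> \<exists>w. dir_deriv v (dir_deriv v f) x +
      (2 * hdot (dir_deriv v f x) (f x) / (1 - hdot (f x) (f x))) *s dir_deriv v f x
      = dir_deriv w f x"
  shows False
proof -
  define D where "D v x = dir_deriv v f x" for v x
  define DD where "DD w v x = dir_deriv w (D v) x" for w v x
  define a b c where "a = D (axis 1 1)" and "b = D (axis 2 1)" and "c = D (axis 3 1)"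
  define m where "m x = line_vec (a x) (b x) (c x)" for x
  define Dm where "Dm v x = dir_deriv v m x" for v x
  define DDm where "DDm w v x = dir_deriv w (Dm v) x" for w v x
  define \<rho> where "\<rho> x = 1 - hdot (f x) (f x)" for x
  define k where "k x = hdot (m x) (f x) / \<rho> x" for x
  have D_smooth: "smooth_on U (D v)" for v
    using smooth_on_dir_deriv[OF f] by (simp add: D_def[abs_def])
  have m_smooth: "smooth_on U m"
    unfolding m_def[abs_def] line_vec_def a_def b_def c_def
    by (intro smooth_on_add smooth_on_diff U(1) D_smooth
        smooth_on_bounded_bilinear[OF U(1) bounded_bilinear_smult]
        smooth_on_bounded_linear[OF U(1) bounded_linear_cnj]
        smooth_on_bounded_bilinear[OF U(1) bounded_bilinear_det2])
  have Dm_smooth: "smooth_on U (Dm v)" for v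
    using smooth_on_dir_deriv[OF m_smooth] by (simp add: Dm_def[abs_def])
  have f': "(f has_derivative (\<lambda>v. D v x)) (at x)" if "x \<in> U" for x
    using smooth_on_has_derivative[OF f that] by (simp add: D_def)
  have D': "(D v has_derivative (\<lambda>w. DD w v x)) (at x)" if "x \<in> U" for x v
    using smooth_on_has_derivative[OF D_smooth that] by (simp add: DD_def)
  have m': "(m has_derivative (\<lambda>v. Dm v x)) (at x)" if "x \<in> U" for x
    using smooth_on_has_derivative[OF m_smooth that] by (simp add: Dm_def)
  have Dm': "(Dm v has_derivative (\<lambda>w. DDm w v x)) (at x)" if "x \<in> U" for x v
    using smooth_on_has_derivative[OF Dm_smooth that] by (simp add: DDm_def)
  have DD_commute: "DD w v x = DD v w x" if "x \<in> U" for x v w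
    using dir_deriv_commute[OF f U(1) that] by (simp add: DD_def D_def[abs_def])
  have DDm_commute: "DDm w v x = DDm v w x" if "x \<in> U" for x v w
    using dir_deriv_commute[OF m_smooth U(1) that] by (simp add: DDm_def Dm_def[abs_def])
  have linD: "linear (\<lambda>v. D v x)" if "x \<in> U" for x
    using f'[OF that] by (rule has_derivative_linear)
  have D_eq: "D v x = v $ 1 *\<^sub>R a x + v $ 2 *\<^sub>R b x + v $ 3 *\<^sub>R c x" if "x \<in> U" for x v
  proof -
    have "v = v $ 1 *\<^sub>R axis 1 1 + v $ 2 *\<^sub>R axis 2 1 + v $ 3 *\<^sub>R axis 3 1"
      by (simp add: vec_eq_iff forall_3 axis_def)
    from arg_cong[OF this, of "\<lambda>v. D v x"] show ?thesis
      by (simp add: a_def b_def c_def linear_add[OF linD[OF that]] linear_scale[OF linD[OF that]])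
  qed
  have indep: "r = 0 \<and> s = 0 \<and> t = 0" if "x \<in> U" "r *\<^sub>R a x + s *\<^sub>R b x + t *\<^sub>R c x = 0" for x r s t
  proof -
    have "D (vector [r, s, t]) x = D 0 x"
      using that linear_0[OF linD[OF that(1)]] by (simp add: D_eq)
    then have "vector [r, s, t] = (0 :: real ^ 3)"
      using inj[OF that(1)] by (auto simp: D_def dest: injD)
    then show ?thesis by (simp add: vec_eq_iff forall_3)
  qed
  have m_nz: "m x \<noteq> 0" if "x \<in> U" for x
    unfolding m_def by (rule line_vec_nonzero) (rule indep[OF that])
  have conormal: "Re (det2 (D v x) (m x)) = 0" if "x \<in> U" for x v
    unfolding D_eq[OF that] m_def by (rule Re_det2_line_vec)
  have \<rho>_real: "Im (\<rho> x) = 0" "Re (\<rho> x) > 0" if "x \<in> U" for x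
    using ball[OF that] by (auto simp: \<rho>_def hdot_self)
  \<comment> \<open>The witnesses here and in \<open>D_im\<close> list the real coefficients from
    \<open>line_vec_Re\<close> and \<open>line_vec_Im\<close>.\<close>
  have D_m: "\<exists>v. D v x = m x" if "x \<in> U" for x
    by (rule exI[of _ "vector [2 * Re (det2 (b x) (c x)), - (2 * Re (det2 (a x) (c x))), 2 * Re (det2 (a x) (b x))]"])
      (simp add: D_eq[OF that] m_def line_vec_Re)
  have D_im: "\<exists>v. D v x = \<i> *s m x" if "x \<in> U" for x
    by (rule exI[of _ "vector [2 * Im (det2 (b x) (c x)), - (2 * Im (det2 (a x) (c x))), 2 * Im (det2 (a x) (b x))]"])
      (simp add: D_eq[OF that] m_def line_vec_Im)

  \<comment> \<open>By \<open>conormal\<close> this imaginary part carries all of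
    \<open>det2 (D v x) (m x)\<close>; it vanishes exactly when \<open>D v x\<close> is in the
    complex line of \<open>m x\<close>. The form \<open>\<beta>\<close> is the imaginary part of
    half the coefficient in \<open>geo\<close>.\<close>
  define \<theta> where "\<theta> v x = Im (det2 (D v x) (m x))" for v x
  define \<beta> where "\<beta> v x = Im (hdot (D v x) (f x) / \<rho> x)" for v x
  have det_\<theta>: "det2 (D v x) (m x) = \<i> * of_real (\<theta> v x)" if "x \<in> U" for v x
    using conormal[OF that] by (simp add: \<theta>_def complex_eq_iff)
  \<comment> \<open>Pairing \<open>geo\<close> with the conormal kills the tangent vector
    \<open>D w x\<close>; as \<open>det2 (D v x) (m x)\<close> is imaginary, only the imaginary part
    of the coefficient survives.\<close>
  have second1: "Re (det2 (DD v v x) (m x)) = 2 * \<theta> v x * \<beta> v x" if x: "x \<in> U" for v x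
  proof -
    obtain w where w: "DD v v x + (2 * hdot (D v x) (f x) / \<rho> x) *s D v x = D w x"
      using geo[OF x, of v] unfolding DD_def D_def[abs_def] \<rho>_def by blast
    have "det2 (DD v v x) (m x) =
      det2 (D w x) (m x) - 2 * (hdot (D v x) (f x) / \<rho> x) * det2 (D v x) (m x)"
      unfolding w[symmetric] by (simp add: bounded_bilinear.add_left[OF bounded_bilinear_det2])
    then show ?thesis
      unfolding det_\<theta>[OF x] \<beta>_def by (simp del: times_divide_eq_left times_divide_eq_right)
  qed
  \<comment> \<open>Polarisation of \<open>second1\<close>, using the symmetry of
    \<open>DD\<close>.\<close>
  have second: "Re (det2 (DD w v x) (m x)) = \<theta> v x * \<beta> w x + \<theta> w x * \<beta> v x" if x: "x \<in> U" for v w x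
  proof -
    have D_add: "D (v + w) y = D v y + D w y" if "y \<in> U" for y
      using linear_add[OF linD[OF that]] .
    have "((\<lambda>y. D v y + D w y) has_derivative (\<lambda>h. DD h v x + DD h w x)) (at x)"
      by (intro has_derivative_add D' x)
    then have "(D (v + w) has_derivative (\<lambda>h. DD h v x + DD h w x)) (at x)"
      by (rule has_derivative_transform_within_open[OF _ U(1) x]) (simp add: D_add)
    then have "(\<lambda>h. DD h (v + w) x) = (\<lambda>h. DD h v x + DD h w x)"
      using D'[OF x] has_derivative_unique by blast
    then have "DD (v + w) (v + w) x = DD (v + w) v x + DD (v + w) w x" by metis
    also have "\<dots> = DD v v x + DD w w x + (DD w v x + DD w v x)"
      using linear_add[OF has_derivative_linear[OF D'[OF x]]] DD_commute[OF x] by simp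
    finally have eq: "DD (v + w) (v + w) x = \<dots>" .
    have "\<theta> (v + w) x = \<theta> v x + \<theta> w x"
      by (simp add: \<theta>_def D_add[OF x] bounded_bilinear.add_left[OF bounded_bilinear_det2])
    moreover have "\<beta> (v + w) x = \<beta> v x + \<beta> w x"
      by (simp add: \<beta>_def D_add[OF x] bounded_bilinear.add_left[OF bounded_bilinear_hdot] add_divide_distrib)
    moreover have "Re (det2 (DD (v + w) (v + w) x) (m x)) =
        Re (det2 (DD v v x) (m x)) + Re (det2 (DD w w x) (m x)) + 2 * Re (det2 (DD w v x) (m x))"
      unfolding eq bounded_bilinear.add_left[OF bounded_bilinear_det2] by simp
    ultimately show ?thesis
      using second1[OF x, of "v + w"] second1[OF x, of v] second1[OF x, of w]
      by (simp add: algebra_simps)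
  qed
  \<comment> \<open>Differentiating \<open>conormal\<close> moves the derivative from
    \<open>D v\<close> to \<open>m\<close>.\<close>
  have first: "Re (det2 (D v x) (Dm w x)) = - (\<theta> v x * \<beta> w x + \<theta> w x * \<beta> v x)" if x: "x \<in> U" for v w x
  proof -
    have d1: "((\<lambda>y. Re (det2 (D v y) (m y))) has_derivative
        (\<lambda>w. Re (det2 (D v x) (Dm w x) + det2 (DD w v x) (m x)))) (at x)"
      by (intro has_derivative_Re bounded_bilinear.FDERIV[OF bounded_bilinear_det2] D' m' x)
    have d2: "((\<lambda>y. Re (det2 (D v y) (m y))) has_derivative (\<lambda>w. 0)) (at x)"
      by (rule has_derivative_transform_within_open[OF has_derivative_const U(1) x])
        (simp add: conormal)
    from fun_cong[OF has_derivative_unique[OF d1 d2], of w]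
    have "Re (det2 (D v x) (Dm w x) + det2 (DD w v x) (m x)) = 0" .
    with second[OF x] show ?thesis by simp
  qed
  txt \<open>Here \<open>first\<close> is applied to the tangent vectors \<open>m\<close> and \<open>\<i> m\<close>, on which \<open>\<theta>\<close> vanishes.\<close>
  have star: "det2 (m x) (Dm w x) = det2 (D w x) (m x) * k x" if x: "x \<in> U" for w x
  proof -
    obtain v1 v2 where v: "D v1 x = m x" "D v2 x = \<i> *s m x"
      using D_m[OF x] D_im[OF x] by blast
    have "\<theta> v1 x = 0" "\<theta> v2 x = 0" by (simp_all add: \<theta>_def v)
    then have "Re (det2 (m x) (Dm w x)) = - \<theta> w x * Im (k x)"
        "Im (det2 (m x) (Dm w x)) = \<theta> w x * Re (k x)"
      using first[OF x, of v1 w] first[OF x, of v2 w] by (simp_all add: v \<beta>_def k_def times_divide_eq_right[symmetric] del: times_divide_eq_right)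
    then show ?thesis by (simp add: det_\<theta>[OF x] complex_eq_iff)
  qed

  define k' where "k' h = ((hdot (m u) (D h u) + hdot (Dm h u) (f u)) * \<rho> u +
    hdot (m u) (f u) * (hdot (f u) (D h u) + hdot (D h u) (f u))) / (\<rho> u)\<^sup>2" for h
  have \<rho>_nz: "\<rho> u \<noteq> 0" using \<rho>_real[OF U(2)] by auto
  have \<rho>': "(\<rho> has_derivative (\<lambda>h. 0 - (hdot (f u) (D h u) + hdot (D h u) (f u)))) (at u)"
    unfolding \<rho>_def[abs_def]
    by (intro has_derivative_diff has_derivative_const bounded_bilinear.FDERIV[OF bounded_bilinear_hdot] f' U)
  have num: "((\<lambda>x. hdot (m x) (f x)) has_derivative (\<lambda>h. hdot (m u) (D h u) + hdot (Dm h u) (f u))) (at u)"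
    by (intro bounded_bilinear.FDERIV[OF bounded_bilinear_hdot] m' f' U)
  have k': "(k has_derivative k') (at u)"
    unfolding k_def[abs_def]
    by (rule has_derivative_eq_rhs[OF has_derivative_divide'[OF num \<rho>' \<rho>_nz]])
      (simp_all add: k'_def fun_eq_iff power2_eq_square algebra_simps)
  \<comment> \<open>The identity \<open>star\<close>, differentiated at \<open>u\<close> in the
    direction \<open>h\<close>.\<close>
  have star': "det2 (m u) (DDm h v u) + det2 (Dm h u) (Dm v u) =
      det2 (D v u) (m u) * k' h + (det2 (D v u) (Dm h u) + det2 (DD h v u) (m u)) * k u" for h v
  proof -
    have d1: "((\<lambda>x. det2 (m x) (Dm v x)) has_derivative (\<lambda>h. det2 (m u) (DDm h v u) + det2 (Dm h u) (Dm v u))) (at u)"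
      by (intro bounded_bilinear.FDERIV[OF bounded_bilinear_det2] Dm' m' U)
    have "((\<lambda>x. det2 (D v x) (m x) * k x) has_derivative
        (\<lambda>h. det2 (D v u) (m u) * k' h + (det2 (D v u) (Dm h u) + det2 (DD h v u) (m u)) * k u)) (at u)"
      by (intro bounded_bilinear.FDERIV[OF bounded_bilinear_det2] has_derivative_mult k' D' m' U)
    then have d2: "((\<lambda>x. det2 (m x) (Dm v x)) has_derivative
        (\<lambda>h. det2 (D v u) (m u) * k' h + (det2 (D v u) (Dm h u) + det2 (DD h v u) (m u)) * k u)) (at u)"
      by (rule has_derivative_transform_within_open[OF _ U]) (simp add: star)
    show ?thesis using fun_cong[OF has_derivative_unique[OF d1 d2], of h] .
  qed
  obtain v where v: "D v u = m u" using D_m[OF U(2)] by blast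
  obtain w where w: "det2 (D w u) (m u) \<noteq> 0"
    using line_vec_transverse m_nz[OF U(2)] unfolding m_def a_def b_def c_def by blast
  \<comment> \<open>With \<open>D v u = m u\<close> the right side of \<open>star\<close> vanishes,
    so \<open>Dm v u\<close> is a complex multiple of \<open>m u\<close>.\<close>
  have "det2 (m u) (Dm v u) = 0"
    using star[OF U(2), of v] by (simp add: v)
  then obtain l where l: "Dm v u = l *s m u"
    using m_nz[OF U(2)] by (metis det2_eq_0)
  define \<tau> where "\<tau> = det2 (D w u) (m u)"
  have \<tau>: "det2 (m u) (Dm w u) = \<tau> * k u" using star[OF U(2)] by (simp add: \<tau>_def)
  \<comment> \<open>The identity for \<open>w\<close> is differentiated along \<open>v\<close>, and
    the one for \<open>v\<close> along \<open>w\<close>, where \<open>k' w\<close> has coefficient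
    zero. Subtraction cancels the symmetric terms \<open>DDm v w u\<close> and
    \<open>DD v w u\<close>.\<close>
  have "det2 (m u) (DDm v w u) + l * (\<tau> * k u) = \<tau> * k' v + (l * \<tau> + det2 (DD v w u) (m u)) * k u"
    using star'[of v w] by (simp add: l \<tau> flip: \<tau>_def)
  moreover have "det2 (m u) (DDm v w u) - l * (\<tau> * k u) = (\<tau> * k u + det2 (DD v w u) (m u)) * k u"
    using star'[of w v] det2_commute[of "Dm w u" "m u"] DD_commute[OF U(2), of w v] DDm_commute[OF U(2), of w v]
    by (simp add: v l \<tau>)
  ultimately have "\<tau> * (k' v - l * k u - k u * k u) = 0"
    by (simp add: algebra_simps)
  then have "k' v - l * k u - k u * k u = 0"
    using w by (simp add: \<tau>_def)
  moreover have "cnj (k u) = hdot (f u) (m u) / \<rho> u"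
    using \<rho>_real[OF U(2)] by (simp add: k_def cnj_hdot complex_eq_iff[of "cnj (\<rho> u)"])
  \<comment> \<open>The explicit quotient rule leaves a remainder with positive first term and
    nonnegative second term.\<close>
  then have "k' v - l * k u - k u * k u = hdot (m u) (m u) / \<rho> u + k u * cnj (k u)"
    using \<rho>_nz unfolding k'_def v l by (simp add: k_def field_simps power2_eq_square)
  ultimately have "Re (hdot (m u) (m u) / \<rho> u) + (cmod (k u))\<^sup>2 = 0"
    by (metis Re_complex_of_real complex_mod_mult_cnj complex_norm_square plus_complex.simps(1) zero_complex.simps(1))
  moreover have "Re (hdot (m u) (m u) / \<rho> u) = Re (hdot (m u) (m u)) / Re (\<rho> u)"
    using \<rho>_real[OF U(2)] by (metis Re_divide_of_real complex_is_Real_iff of_real_Re)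
  ultimately show False
    using hdot_self_pos[OF m_nz[OF U(2)]] \<rho>_real[OF U(2)]
    by (smt (verit) divide_pos_pos zero_le_power2)
qed


subsection \<open>Geodesics in the affine chart\<close>

abbreviation chart_CH2 :: "complex ^ 2 \<Rightarrow> (complex ^ 3) set" where
  "chart_CH2 \<equiv> \<lambda>z. cline (affine_lift z)"

section \<open>Lifts of points and of tangent vectors\<close>

definition tan_lift :: "complex ^ 2 \<Rightarrow> complex ^ 3" where
  "tan_lift v = (\<chi> i. if i = 0 then 0 else if i = 1 then v $ 1 else v $ 2)"

lemma tan_lift_nth [simp]: "tan_lift v $ 0 = 0" "tan_lift v $ 1 = v $ 1" "tan_lift v $ 2 = v $ 2"
  by (simp_all add: tan_lift_def)

lemma affine_lift_has_derivative: "(affine_lift has_derivative tan_lift) (at z)"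
proof -
  have "linear tan_lift"
    by (rule linearI) (simp_all add: tan_lift_def vec_eq_iff)
  then have "((\<lambda>z. affine_lift 0 + tan_lift z) has_derivative tan_lift) (at z)"
    by (auto intro!: derivative_eq_intros simp: linear_linear bounded_linear_imp_has_derivative)
  moreover have "(\<lambda>z. affine_lift 0 + tan_lift z) = affine_lift"
    by (simp add: fun_eq_iff vec_eq_iff all_3)
  ultimately show ?thesis by simp
qed

lemma herm_lift:
  "herm (affine_lift y) (affine_lift z) = hdot y z - 1"
  "herm (tan_lift v) (affine_lift z) = hdot v z"
  "herm (affine_lift z) (tan_lift v) = hdot z v"
  "herm (tan_lift v) (tan_lift w) = hdot v w"
  by (simp_all add: herm_def hdot_def)

lemma affine_lift_in_chart: "affine_lift z \<in> chart_CH2 z"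
  unfolding cline_def by (rule range_eqI[of _ _ 1]) simp

text \<open>Evaluation at the normalised representative, whose coordinate 0 is 1, removes the factor
  \<open>q $ 0\<close> of \<open>diff_CH2\<close>.\<close>

lemma diff_CH2_eq:
  assumes "((\<lambda>x. affine_coord (\<phi> x)) has_derivative g) (at u)" "\<phi> u = chart_CH2 z"
  shows "diff_CH2 \<phi> u v (affine_lift z) = perp_proj (affine_lift z) (tan_lift (g v))"
proof -
  have "((\<lambda>x. affine_lift (affine_coord (\<phi> x))) has_derivative (\<lambda>v. tan_lift (g v))) (at u)"
    by (rule has_derivative_compose[OF assms(1) affine_lift_has_derivative])
  from frechet_derivative_at[OF this]
  have "frechet_derivative (\<lambda>x. affine_lift (affine_coord (\<phi> x))) (at u) = (\<lambda>v. tan_lift (g v))" ..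
  then show ?thesis
    using affine_lift_in_chart by (simp add: diff_CH2_def Let_def assms(2) affine_coord_cline)
qed

text \<open>Coordinate 0 of the projection reveals the multiple of \<open>affine_lift z\<close> that
  was subtracted. Hence a tangent vector determines the velocity in the chart.\<close>

lemma perp_proj_tan_lift_inj:
  assumes "perp_proj (affine_lift z) (tan_lift v) = perp_proj (affine_lift z) (tan_lift w)"
  shows "v = w"
proof -
  define c where "c = herm (tan_lift v) (affine_lift z) / herm (affine_lift z) (affine_lift z)"
  define d where "d = herm (tan_lift w) (affine_lift z) / herm (affine_lift z) (affine_lift z)"
  have eq: "tan_lift v - c *s affine_lift z = tan_lift w - d *s affine_lift z"
    using assms by (simp add: perp_proj_def c_def d_def)
  from arg_cong[OF eq, of "\<lambda>x. x $ 0"] have "c = d" by simp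
  then show ?thesis
    using arg_cong[OF eq, of "\<lambda>x. x $ 1"] arg_cong[OF eq, of "\<lambda>x. x $ 2"]
    by (simp add: vec_eq_iff forall_2)
qed

text \<open>The Bergman metric of the unit ball, up to a constant factor.\<close>

definition ball_metric :: "complex ^ 2 \<Rightarrow> complex ^ 2 \<Rightarrow> complex ^ 2 \<Rightarrow> real" where
  "ball_metric z v w =
    Re (hdot v w / (1 - hdot z z) + hdot v z * hdot z w / (1 - hdot z z)\<^sup>2)"

lemma pullback_metric_chart:
  assumes z: "Re (hdot z z) < 1"
  shows "pullback_metric chart_CH2 z v w = ball_metric z v w"
proof -
  let ?p = "affine_lift z"
  have CH2: "chart_CH2 z \<in> CH2"
    using z by (auto simp: CH2_eq_chart herm_lift)
  have "?p \<noteq> 0"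
    using affine_lift_nth(1)[of z] by (metis zero_index zero_neq_one)
  have coord: "((\<lambda>x. affine_coord (chart_CH2 x)) has_derivative (\<lambda>v. v)) (at z)"
    by (simp add: affine_coord_cline)
  have diff: "diff_CH2 chart_CH2 z v ?p = perp_proj ?p (tan_lift v)" for v
    by (rule diff_CH2_eq[OF coord]) simp
  have "hdot z z \<noteq> 1" using z by auto
  then have h: "1 - hdot z z \<noteq> 0" by simp
  have herm_diff: "herm (x - y) (x' - y') = herm x x' - herm x y' - herm y x' + herm y y'" for x y x' y'
    by (simp add: herm_def algebra_simps)
  have H: "herm (perp_proj ?p (tan_lift v)) (perp_proj ?p (tan_lift w))
      = hdot v w + hdot v z * hdot z w / (1 - hdot z z)"
    unfolding perp_proj_def herm_diff herm_scale herm_lift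
    using h by (simp add: cnj_hdot divide_simps) (simp add: algebra_simps)
  have "- herm (diff_CH2 chart_CH2 z v ?p) (diff_CH2 chart_CH2 z w ?p) / herm ?p ?p
      = hdot v w / (1 - hdot z z) + hdot v z * hdot z w / (1 - hdot z z)\<^sup>2"
    unfolding diff H herm_lift using h
    by (simp add: divide_simps power2_eq_square) (simp add: algebra_simps)
  then show ?thesis
    unfolding pullback_metric_def riem_CH2_def ball_metric_def
    using tangent_herm_eq[OF refl \<open>?p \<noteq> 0\<close> diff_CH2_tangent[where \<phi> = chart_CH2 and u = z, OF CH2]
      diff_CH2_tangent[where \<phi> = chart_CH2 and u = z, OF CH2]] by simp
qed

lemma open_unit_ball: "open {z. Re (hdot z z) < 1}"
  unfolding hdot_def by (intro open_Collect_less continuous_intros)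

lemma ball_metric_deriv:
  assumes z: "Re (hdot z z) < 1"
  shows "frechet_derivative (\<lambda>y. pullback_metric chart_CH2 y v w) (at z) h =
    Re (hdot v w * (hdot z h + hdot h z) / (1 - hdot z z)\<^sup>2 +
        (hdot v z * hdot h w + hdot v h * hdot z w) / (1 - hdot z z)\<^sup>2 +
        2 * (hdot v z * hdot z w) * (hdot z h + hdot h z) / (1 - hdot z z) ^ 3)" (is "_ = ?d h")
proof -
  have "hdot z z \<noteq> 1" using z by auto
  then have h: "1 - hdot z z \<noteq> 0" by simp
  then have hh: "(1 - hdot z z) * (1 - hdot z z) \<noteq> 0" by simp
  \<comment> \<open>The left side has the shape that the quotient rule produces for
    \<open>a / q + b / (q * q)\<close> when \<open>q\<close> has derivative
    \<open>0 - s\<close>.\<close>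
  have quot: "(0 * q - a * (0 - s)) / (q * q) +
      (b' * (q * q) - b * (q * (0 - s) + (0 - s) * q)) / (q * q * (q * q))
      = a * s / (q * q) + b' / (q * q) + 2 * b * s / q ^ 3"
    if "q \<noteq> 0" for q a b b' s :: complex
  proof -
    have "b' * (q * q) - b * (q * (0 - s) + (0 - s) * q) = b' * (q * q) + 2 * b * s * q"
      by simp
    then show ?thesis
      using that by (simp add: add_divide_distrib power3_eq_cube mult_ac)
  qed
  have \<rho>: "((\<lambda>y. 1 - hdot y y) has_derivative (\<lambda>h. 0 - (hdot z h + hdot h z))) (at z)"
    by (intro has_derivative_diff has_derivative_const bounded_bilinear.FDERIV[OF bounded_bilinear_hdot]
        has_derivative_ident)
  have v: "((\<lambda>y. hdot v y) has_derivative (\<lambda>h. hdot v h)) (at z)"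
    and w: "((\<lambda>y. hdot y w) has_derivative (\<lambda>h. hdot h w)) (at z)"
    by (simp_all add: bounded_linear_imp_has_derivative
        bounded_bilinear.bounded_linear_right[OF bounded_bilinear_hdot]
        bounded_bilinear.bounded_linear_left[OF bounded_bilinear_hdot])
  have "((\<lambda>y. ball_metric y v w) has_derivative ?d) (at z)"
    unfolding ball_metric_def power2_eq_square[of "1 - hdot _ _"]
    by (rule has_derivative_eq_rhs, rule has_derivative_Re[OF has_derivative_add[OF
          has_derivative_divide'[OF has_derivative_const \<rho> h]
          has_derivative_divide'[OF has_derivative_mult[OF v w] has_derivative_mult[OF \<rho> \<rho>] hh]]])
      (intro ext arg_cong[where f = Re], rule quot[OF h])
  then have "((\<lambda>y. pullback_metric chart_CH2 y v w) has_derivative ?d) (at z)"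
    by (rule has_derivative_transform_within_open[OF _ open_unit_ball])
      (use z in \<open>auto simp: pullback_metric_chart\<close>)
  from fun_cong[OF frechet_derivative_at[OF this], of h] show ?thesis ..
qed

text \<open>The covariant derivative of the constant field \<open>u\<close> along itself is a
  complex multiple of \<open>u\<close>; geodesics in the chart therefore stay in complex affine
  lines.\<close>

lemma christoffel_chart:
  assumes z: "Re (hdot z z) < 1"
  shows "christoffel (pullback_metric chart_CH2) z u u w =
    ball_metric z ((2 * hdot u z / (1 - hdot z z)) *s u) w"
proof -
  obtain r where r: "1 - hdot z z = complex_of_real r" and "r > 0"
    using z by (intro that[of "Re (1 - hdot z z)"]) (simp_all add: hdot_self)
  obtain n where n: "hdot u u = complex_of_real n"
    by (metis hdot_self)
  have c: "hdot z u = cnj (hdot u z)" "hdot w u = cnj (hdot u w)" "hdot w z = cnj (hdot z w)"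
    by (simp_all add: cnj_hdot)
  show ?thesis
    using \<open>r > 0\<close>
    unfolding christoffel_def ball_metric_deriv[OF z] unfolding ball_metric_def hdot_smult
    unfolding r n c of_real_power[symmetric]
    by (simp add: divide_simps power2_eq_square power3_eq_cube) (simp add: algebra_simps)
qed

lemma ball_metric_add: "ball_metric z (u + v) w = ball_metric z u w + ball_metric z v w"
  by (simp add: ball_metric_def bounded_bilinear.add_left[OF bounded_bilinear_hdot]
      add_divide_distrib distrib_right)

lemma ball_metric_pos:
  assumes z: "Re (hdot z z) < 1" and "v \<noteq> 0"
  shows "ball_metric z v v > 0"
proof -
  obtain r where r: "1 - hdot z z = complex_of_real r" and "r > 0"
    using z by (intro that[of "Re (1 - hdot z z)"]) (simp_all add: hdot_self)
  have e: "hdot v z * hdot z v = complex_of_real ((cmod (hdot v z))\<^sup>2)"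
    by (simp add: complex_norm_square cnj_hdot del: of_real_power)
  have "ball_metric z v v = Re (hdot v v) / r + (cmod (hdot v z))\<^sup>2 / r\<^sup>2"
    unfolding ball_metric_def r e of_real_power[symmetric] of_real_divide[symmetric]
    by (simp del: of_real_power of_real_divide)
  then show ?thesis
    using hdot_self_pos[OF \<open>v \<noteq> 0\<close>] \<open>r > 0\<close> by (simp add: add_pos_nonneg)
qed

text \<open>The geodesic equation is tested against every \<open>w\<close>; taking for
  \<open>w\<close> the left side of the vector equation, positive definiteness forces it to
  vanish.\<close>

lemma metric_geodesic_chart:
  assumes "metric_geodesic (pullback_metric chart_CH2) J y"
    and y: "\<And>t. t \<in> J \<Longrightarrow> Re (hdot (y t) (y t)) < 1"
  obtains y' y'' where
    "\<And>t. t \<in> J \<Longrightarrow> (y has_vector_derivative y' t) (at t)"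
    "\<And>t. t \<in> J \<Longrightarrow> (y' has_vector_derivative y'' t) (at t)"
    "\<And>t. t \<in> J \<Longrightarrow> y'' t + (2 * hdot (y' t) (y t) / (1 - hdot (y t) (y t))) *s y' t = 0"
proof -
  obtain y' y'' where *: "\<And>t. t \<in> J \<Longrightarrow> (y has_vector_derivative y' t) (at t)"
    "\<And>t. t \<in> J \<Longrightarrow> (y' has_vector_derivative y'' t) (at t)"
    and geo: "\<And>t w. t \<in> J \<Longrightarrow> pullback_metric chart_CH2 (y t) (y'' t) w +
      christoffel (pullback_metric chart_CH2) (y t) (y' t) (y' t) w = 0"
    using assms(1) unfolding metric_geodesic_def by blast
  have "y'' t + (2 * hdot (y' t) (y t) / (1 - hdot (y t) (y t))) *s y' t = 0" if "t \<in> J" for t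
    using geo[OF that] ball_metric_pos[OF y[OF that]]
    unfolding pullback_metric_chart[OF y[OF that]] christoffel_chart[OF y[OF that]] ball_metric_add[symmetric]
    by (metis less_irrefl)
  with * that show ?thesis by blast
qed

section \<open>First and second derivatives along curves\<close>

lemma has_vector_derivative_smooth_comp:
  assumes f: "smooth_on U f" and U: "x t \<in> U"
    and x: "(x has_vector_derivative x') (at t)"
  shows "((\<lambda>s. f (x s)) has_vector_derivative dir_deriv x' f (x t)) (at t)"
proof -
  have f': "(f has_derivative frechet_derivative f (at (x t))) (at (x t))"
    using smooth_on_has_derivative[OF f U] .
  have "((\<lambda>s. f (x s)) has_derivative (\<lambda>h. dir_deriv (h *\<^sub>R x') f (x t))) (at t)"
    using has_derivative_compose[OF x[unfolded has_vector_derivative_def] f'] .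
  then show ?thesis
    by (simp add: has_vector_derivative_def linear_scale[OF has_derivative_linear[OF f']])
qed

text \<open>Direction and base point both move with \<open>s\<close>; expanding the direction in the
  basis separates the two dependences, so that the product rule applies.\<close>

lemma has_vector_derivative_smooth_comp2:
  assumes f: "smooth_on U f" and U: "open U" and J: "open J" "t \<in> J"
    and x: "\<And>s. s \<in> J \<Longrightarrow> x s \<in> U" "\<And>s. s \<in> J \<Longrightarrow> (x has_vector_derivative x' s) (at s)"
    and x': "(x' has_vector_derivative x'') (at t)"
  shows "((\<lambda>s. dir_deriv (x' s) f (x s)) has_vector_derivative
    dir_deriv (x' t) (dir_deriv (x' t) f) (x t) + dir_deriv x'' f (x t)) (at t)"
proof -
  have lin: "linear (\<lambda>v. dir_deriv v g y)" if "smooth_on U g" "y \<in> U" for g :: "'a \<Rightarrow> 'b" and y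
    using has_derivative_linear[OF smooth_on_has_derivative[OF that]] .
  have expand: "(\<Sum>b\<in>Basis. (v \<bullet> b) *\<^sub>R dir_deriv b g y) = dir_deriv v g y"
    if "smooth_on U g" "y \<in> U" for g :: "'a \<Rightarrow> 'b" and y v
    using linear_sum[OF lin[OF that], of "\<lambda>b. (v \<bullet> b) *\<^sub>R b" Basis] linear_scale[OF lin[OF that]]
    by (simp add: euclidean_representation)
  have D: "smooth_on U (dir_deriv v f)" for v
    using f by (rule smooth_on_dir_deriv)
  have "((\<lambda>s. \<Sum>b\<in>Basis. (x' s \<bullet> b) *\<^sub>R dir_deriv b f (x s)) has_vector_derivative
     (\<Sum>b\<in>Basis. (x' t \<bullet> b) *\<^sub>R dir_deriv (x' t) (dir_deriv b f) (x t) + (x'' \<bullet> b) *\<^sub>R dir_deriv b f (x t))) (at t)"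
    by (rule has_vector_derivative_sum, rule has_vector_derivative_scaleR)
      (simp_all add: has_real_derivative_iff_has_vector_derivative J x has_vector_derivative_smooth_comp[OF D]
        bounded_linear.has_vector_derivative[OF bounded_linear_inner_left x'])
  \<comment> \<open>The sum runs over the inner direction; symmetry makes it the outer one, where
    linearity applies.\<close>
  moreover have "(\<Sum>b\<in>Basis. (x' t \<bullet> b) *\<^sub>R dir_deriv (x' t) (dir_deriv b f) (x t)) =
      dir_deriv (x' t) (dir_deriv (x' t) f) (x t)"
    using expand[OF D x(1)[OF J(2)], of "x' t" "x' t"] dir_deriv_commute[OF f U x(1)[OF J(2)]] by simp
  ultimately have "((\<lambda>s. \<Sum>b\<in>Basis. (x' s \<bullet> b) *\<^sub>R dir_deriv b f (x s)) has_vector_derivative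
      dir_deriv (x' t) (dir_deriv (x' t) f) (x t) + dir_deriv x'' f (x t)) (at t)"
    using expand[OF f x(1)[OF J(2)]] by (simp add: sum.distrib)
  then show ?thesis
    by (rule has_vector_derivative_transform_within_open[OF _ J]) (simp add: expand[OF f x(1)])
qed


subsection \<open>Totally geodesic submanifolds\<close>

text \<open>A geodesic of the submanifold with initial velocity \<open>v\<close> is an ambient
  geodesic \<open>y\<close>. Writing \<open>y\<close> as \<open>f\<close> after a curve
  \<open>c\<close> and differentiating twice turns the ambient equation into the claim.\<close>

lemma totally_geodesic_second_fundamental_form:
  fixes A :: "'a::euclidean_space atlas"
  assumes sub: "submanifold_CH2 S A" and compl: "complete_submanifold S A" and tot: "totally_geodesic A"
    and A: "(U, \<phi>) \<in> A" and u: "u \<in> U"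
    and f_def: "f = (\<lambda>u. affine_coord (\<phi> u))"
  shows "\<exists>w. dir_deriv v (dir_deriv v f) u +
    (2 * hdot (dir_deriv v f u) (f u) / (1 - hdot (f u) (f u))) *s dir_deriv v f u = dir_deriv w f u"
proof -
  have param: "local_param V \<psi>" if "(V, \<psi>) \<in> A" for V \<psi>
    using sub that by (auto simp: submanifold_CH2_def)
  note U = param[OF A, unfolded local_param_def, folded f_def]
  have f: "smooth_on U f" using U by blast
  have "\<phi> u \<in> CH2" using U u by blast
  then obtain z where z: "\<phi> u = chart_CH2 z" by (auto simp: CH2_eq_chart)
  have "\<phi> u \<in> S" using sub A u by (auto simp: submanifold_CH2_def)
  moreover have "diff_CH2 \<phi> u v \<in> tangent_sub A (\<phi> u)"
    using A u by (auto simp: tangent_sub_def)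
  ultimately obtain \<gamma> where geoA: "geodesic_in A UNIV \<gamma>" and \<gamma>0: "\<gamma> 0 = \<phi> u"
    and vel: "diff_CH2 \<gamma> 0 1 = diff_CH2 \<phi> u v"
    using compl unfolding complete_submanifold_def by blast
  have "geodesic_in CH2_atlas UNIV \<gamma>"
    using tot geoA is_interval_univ unfolding totally_geodesic_def by blast
  then have "\<exists>J x. open J \<and> 0 \<in> J \<and> x ` J \<subseteq> {z. Re (herm (affine_lift z) (affine_lift z)) < 0} \<and>
       (\<forall>s\<in>J. \<gamma> s = chart_CH2 (x s)) \<and> metric_geodesic (pullback_metric chart_CH2) J x"
    unfolding geodesic_in_def CH2_atlas_def by auto
  then obtain J2 y where J2: "open J2" "0 \<in> J2" and y_neg: "y ` J2 \<subseteq> {z. Re (herm (affine_lift z) (affine_lift z)) < 0}"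
    and y: "\<And>s. s \<in> J2 \<Longrightarrow> \<gamma> s = chart_CH2 (y s)"
    and y_geo: "metric_geodesic (pullback_metric chart_CH2) J2 y"
    by blast
  have y_ball: "Re (hdot (y s) (y s)) < 1" if "s \<in> J2" for s
    using y_neg that by (auto simp: herm_lift)
  obtain y' y'' where y': "\<And>t. t \<in> J2 \<Longrightarrow> (y has_vector_derivative y' t) (at t)"
    and y'': "\<And>t. t \<in> J2 \<Longrightarrow> (y' has_vector_derivative y'' t) (at t)"
    and y_eq: "\<And>t. t \<in> J2 \<Longrightarrow> y'' t + (2 * hdot (y' t) (y t) / (1 - hdot (y t) (y t))) *s y' t = 0"
    using metric_geodesic_chart[OF y_geo y_ball] by metis
  from geoA have "\<exists>(V, \<psi>)\<in>A. \<exists>J x. open J \<and> 0 \<in> J \<and> J \<subseteq> UNIV \<and> x ` J \<subseteq> V \<and>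
       (\<forall>s\<in>J. \<gamma> s = \<psi> (x s)) \<and> metric_geodesic (pullback_metric \<psi>) J x"
    unfolding geodesic_in_def by blast
  then obtain V \<psi> J1 x where V: "(V, \<psi>) \<in> A" and J1: "open J1" "0 \<in> J1"
    and xV: "x ` J1 \<subseteq> V" and x: "\<And>s. s \<in> J1 \<Longrightarrow> \<gamma> s = \<psi> (x s)"
    and x_geo: "metric_geodesic (pullback_metric \<psi>) J1 x"
    by blast
  obtain x' x'' where x': "\<And>t. t \<in> J1 \<Longrightarrow> (x has_vector_derivative x' t) (at t)"
    and x'': "\<And>t. t \<in> J1 \<Longrightarrow> (x' has_vector_derivative x'' t) (at t)"
    using x_geo unfolding metric_geodesic_def by blast

  \<comment> \<open>The chart \<open>\<psi>\<close> in which the geodesic is given may differ from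
    \<open>\<phi>\<close>; the transition map \<open>\<tau>\<close> carries its coordinate curve
    into \<open>U\<close>.\<close>
  define W where "W = {v \<in> V. \<psi> v \<in> \<phi> ` U}"
  define \<tau> where "\<tau> = (\<lambda>v. inv_into U \<phi> (\<psi> v))"
  have comp: "compatible_params (V, \<psi>) (U, \<phi>)"
    using sub V A by (simp add: submanifold_CH2_def)
  have W: "open W" and \<tau>: "smooth_on W \<tau>"
    using comp unfolding compatible_params_def W_def \<tau>_def Let_def case_prod_conv by blast+
  have \<tau>_in: "\<tau> v \<in> U" "\<phi> (\<tau> v) = \<psi> v" if "v \<in> W" for v
    using that by (simp_all add: W_def \<tau>_def inv_into_into f_inv_into_f)
  have "continuous_on J1 x"
    using x' by (auto intro!: continuous_at_imp_continuous_on has_vector_derivative_continuous)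
  then have "open (J1 \<inter> x -` W)"
    using W J1 by (simp add: continuous_open_preimage)
  define J where "J = J2 \<inter> (J1 \<inter> x -` W)"
  have "x 0 \<in> W"
    using xV J1 x[of 0] \<gamma>0 u unfolding W_def by auto
  then have J: "open J" "0 \<in> J"
    using \<open>open (J1 \<inter> x -` W)\<close> J1 J2 by (auto simp: J_def)
  have JD: "s \<in> J1" "s \<in> J2" "x s \<in> W" if "s \<in> J" for s using that by (auto simp: J_def)
  define c where "c s = \<tau> (x s)" for s
  define c' where "c' s = dir_deriv (x' s) \<tau> (x s)" for s
  have cU: "c s \<in> U" and \<phi>c: "\<phi> (c s) = \<gamma> s" if "s \<in> J" for s
    using \<tau>_in[OF JD(3)[OF that]] x[OF JD(1)[OF that]] by (simp_all add: c_def)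
  have c': "(c has_vector_derivative c' s) (at s)" if "s \<in> J" for s
    unfolding c_def[abs_def] c'_def
    by (rule has_vector_derivative_smooth_comp[OF \<tau>]) (use JD[OF that] x' in auto)
  have x'_J: "(x has_vector_derivative x' s) (at s)" if "s \<in> J" for s
    using x' JD(1)[OF that] .
  obtain c'' where c'': "(c' has_vector_derivative c'') (at 0)"
    using has_vector_derivative_smooth_comp2[OF \<tau> W J JD(3) x'_J x''[OF J1(2)]]
    unfolding c'_def[abs_def] by blast
  have c0: "c 0 = u"
    using U u cU[OF J(2)] \<phi>c[OF J(2)] \<gamma>0 by (auto dest: inj_onD)
  have fc: "f (c s) = y s" if "s \<in> J" for s
    using \<phi>c[OF that] y[OF JD(2)[OF that]] by (simp add: f_def affine_coord_cline)
  \<comment> \<open>Needed near 0 and not just at 0, since both sides are differentiated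
    again.\<close>
  have y'_eq: "dir_deriv (c' s) f (c s) = y' s" if "s \<in> J" for s
  proof -
    have "((\<lambda>s. f (c s)) has_vector_derivative dir_deriv (c' s) f (c s)) (at s)"
      by (rule has_vector_derivative_smooth_comp[OF f cU c']) (use that in auto)
    then have "(y has_vector_derivative dir_deriv (c' s) f (c s)) (at s)"
      by (rule has_vector_derivative_transform_within_open[OF _ J(1) that]) (simp add: fc)
    then show ?thesis
      using vector_derivative_unique_at y' JD(2)[OF that] by blast
  qed
  have "((\<lambda>s. dir_deriv (c' s) f (c s)) has_vector_derivative
      dir_deriv (c' 0) (dir_deriv (c' 0) f) (c 0) + dir_deriv c'' f (c 0)) (at 0)"
    by (rule has_vector_derivative_smooth_comp2[OF f _ J cU c' c'']) (use U in auto)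
  then have "(y' has_vector_derivative
      dir_deriv (c' 0) (dir_deriv (c' 0) f) (c 0) + dir_deriv c'' f (c 0)) (at 0)"
    by (rule has_vector_derivative_transform_within_open[OF _ J]) (simp add: y'_eq)
  then have y''_eq: "y'' 0 = dir_deriv (c' 0) (dir_deriv (c' 0) f) u + dir_deriv c'' f u"
    using vector_derivative_unique_at y'' J2(2) c0 by metis

  \<comment> \<open>Equality of the tangent vectors yields \<open>y' 0 = dir_deriv v f u\<close>,
    and injectivity of the derivative of \<open>f\<close> then gives
    \<open>c' 0 = v\<close>.\<close>
  have "(y has_derivative (\<lambda>h. h *\<^sub>R y' 0)) (at 0)"
    using y'[OF J2(2)] by (simp add: has_vector_derivative_def)
  then have "((\<lambda>s. affine_coord (\<gamma> s)) has_derivative (\<lambda>h. h *\<^sub>R y' 0)) (at 0)"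
    by (rule has_derivative_transform_within_open[OF _ J2]) (simp add: y affine_coord_cline)
  then have "diff_CH2 \<gamma> 0 1 (affine_lift z) = perp_proj (affine_lift z) (tan_lift (y' 0))"
    using diff_CH2_eq[of \<gamma> _ 0 z 1] \<gamma>0 z by simp
  moreover have "diff_CH2 \<phi> u v (affine_lift z) = perp_proj (affine_lift z) (tan_lift (dir_deriv v f u))"
    by (rule diff_CH2_eq[where \<phi> = \<phi> and u = u, OF _ z])
      (use smooth_on_has_derivative[OF f u] in \<open>simp add: f_def\<close>)
  ultimately have "y' 0 = dir_deriv v f u"
    using vel by (metis perp_proj_tan_lift_inj)
  then have "c' 0 = v"
    using y'_eq[OF J(2)] U u unfolding c0 by (auto dest: injD)
  have lin: "linear (frechet_derivative f (at u))"
    using has_derivative_linear[OF smooth_on_has_derivative[OF f u]] .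
  have "dir_deriv v (dir_deriv v f) u + dir_deriv c'' f u +
    (2 * hdot (dir_deriv v f u) (f u) / (1 - hdot (f u) (f u))) *s dir_deriv v f u = 0"
    using y_eq[OF J2(2)] fc[OF J(2)]
    unfolding y''_eq \<open>y' 0 = _\<close> \<open>c' 0 = v\<close> c0 by simp
  \<comment> \<open>The tangential witness is the negative of the coordinate acceleration
    \<open>c''\<close>.\<close>
  then have "dir_deriv v (dir_deriv v f) u +
    (2 * hdot (dir_deriv v f u) (f u) / (1 - hdot (f u) (f u))) *s dir_deriv v f u = dir_deriv (- c'') f u"
    unfolding linear_neg[OF lin] by (simp add: algebra_simps eq_neg_iff_add_eq_0)
  then show ?thesis by blast
qed

theorem proposition6:
  "\<nexists>(S :: (complex ^ 3) set set) (A :: (real ^ 3) atlas).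
     S \<noteq> {} \<and> submanifold_CH2 S A \<and> complete_submanifold S A \<and> totally_geodesic A"
proof (safe)
  fix S and A :: "(real ^ 3) atlas" and L
  assume sub: "submanifold_CH2 S A" and "complete_submanifold S A" "totally_geodesic A" and "L \<in> S"
  \<comment> \<open>One chart around one point is enough, because the obstruction is local.\<close>
  obtain U \<phi> u where A: "(U, \<phi>) \<in> A" and u: "u \<in> U"
    using sub \<open>L \<in> S\<close> by (auto simp: submanifold_CH2_def)
  define f where "f = (\<lambda>u. affine_coord (\<phi> u))"
  have "local_param U \<phi>" using sub A by (auto simp: submanifold_CH2_def)
  note U = this[unfolded local_param_def, folded f_def]
  show "L \<in> {}"
  proof (rule no_totally_geodesic_hypersurface[THEN FalseE])
    show "Re (hdot (f x) (f x)) < 1" if "x \<in> U" for x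
    proof -
      have "\<phi> x \<in> CH2" using U that by blast
      then show ?thesis by (auto simp: CH2_eq_chart f_def affine_coord_cline herm_lift)
    qed
    show "\<exists>w. dir_deriv v (dir_deriv v f) x +
      (2 * hdot (dir_deriv v f x) (f x) / (1 - hdot (f x) (f x))) *s dir_deriv v f x
      = dir_deriv w f x" if "x \<in> U" for x v
      by (rule totally_geodesic_second_fundamental_form) fact+
  qed (use U u in auto)
qed

end
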